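(* Let $d$ be an integer with $1\le d<q$, and let $r=\sum_{a=1}^{i}\binom{m+d-a}{d-1}-t$ for some positive integer $i\le m+1$ and some nonnegative integer $t<d$. Then $$e_r(d,m)=\mathsf{p}_{m-i}+t\quad\text{and consequently}\quad d_r(\mathrm{PRM}_q(d,m))=\mathsf{p}_m-\mathsf{p}_{m-i}-t.$$
   Context: Let $q$ be a prime power, $\mathbb{F}_q$ the finite field with $q$ elements, $m$ a positive integer. For $j\in\mathbb{Z}$, $\mathsf{p}_j=q^j+\dots+q+1$ if $j\ge0$ and $\mathsf{p}_j=0$ if $j<0$ (so $\mathsf{p}_m=|\mathbb{P}^m(\mathbb{F}_q)|$). $e_r(d,m)$ is the maximum, over all families of $r$ linearly independent homogeneous polynomials of degree $d$ in $\mathbb{F}_q[x_0,\dots,x_m]$, of the number of points of $\mathbb{P}^m(\mathbb{F}_q)$ at which all of them vanish. Fix representatives $P_1,\dots,P_{\mathsf{p}_m}\in\mathbb{F}_q^{m+1}$ of the points of $\mathbb{P}^m(\mathbb{F}_q)$. The projective Reed–Muller code $\mathrm{PRM}_q(d,m)$ is the image of the space of homogeneous degree-$d$ polynomials under $F\mapsto(F(P_1),\dots,F(P_{\mathsf{p}_m}))$. For a linear code $C\subseteq\mathbb{F}_q^n$ of dimension $k$ and $1\le r\le k$, the $r$-th generalized Hamming weight is $d_r(C)=\min\{|\mathrm{Supp}(D)|: D\subseteq C \text{ a subspace}, \dim D=r\}$, where $\mathrm{Supp}(D)=\{i: c_i\neq0\text{ for some }c\in D\}$. *)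

theory Defs
  imports Main "HOL-Library.Cardinality"
begin

definition pvecs :: "nat \<Rightarrow> (nat \<Rightarrow> 'a::field) set" where
  "pvecs m = {v. \<forall>i>m. v i = 0}"

definition Proj :: "nat \<Rightarrow> (nat \<Rightarrow> 'a::field) set set" where
  "Proj m = {{(\<lambda>i. c * v i) | c. c \<noteq> 0} | v. v \<in> pvecs m \<and> (\<exists>i. v i \<noteq> 0)}"

definition mon_exps :: "nat \<Rightarrow> nat \<Rightarrow> (nat \<Rightarrow> nat) set" where
  "mon_exps m d = {\<alpha>. (\<forall>i>m. \<alpha> i = 0) \<and> (\<Sum>i\<le>m. \<alpha> i) = d}"

definition hom_polys :: "nat \<Rightarrow> nat \<Rightarrow> ((nat \<Rightarrow> nat) \<Rightarrow> 'a::field) set" where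
  "hom_polys m d = {F. \<forall>\<alpha>. \<alpha> \<notin> mon_exps m d \<longrightarrow> F \<alpha> = 0}"

definition peval :: "nat \<Rightarrow> nat \<Rightarrow> ((nat \<Rightarrow> nat) \<Rightarrow> 'a::field) \<Rightarrow> (nat \<Rightarrow> 'a) \<Rightarrow> 'a" where
  "peval m d F v = (\<Sum>\<alpha>\<in>mon_exps m d. F \<alpha> * (\<Prod>i\<le>m. v i ^ \<alpha> i))"

definition lin_indep :: "nat \<Rightarrow> (nat \<Rightarrow> 'b \<Rightarrow> 'a::field) \<Rightarrow> bool" where
  "lin_indep r fs = (\<forall>c. (\<forall>x. (\<Sum>j<r. c j * fs j x) = 0) \<longrightarrow> (\<forall>j<r. c j = 0))"

definition zeros :: "nat \<Rightarrow> nat \<Rightarrow> nat \<Rightarrow> (nat \<Rightarrow> (nat \<Rightarrow> nat) \<Rightarrow> 'a::field) \<Rightarrow> (nat \<Rightarrow> 'a) set set" where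
  "zeros m d r fs = {P \<in> Proj m. \<forall>j<r. \<forall>v\<in>P. peval m d (fs j) v = 0}"

definition e_r :: "'a::{finite,field} itself \<Rightarrow> nat \<Rightarrow> nat \<Rightarrow> nat \<Rightarrow> nat" where
  "e_r _ r d m = Max {card (zeros m d r (fs :: nat \<Rightarrow> (nat \<Rightarrow> nat) \<Rightarrow> 'a)) | fs.
      (\<forall>j<r. fs j \<in> hom_polys m d) \<and> lin_indep r fs}"

definition pp :: "nat \<Rightarrow> int \<Rightarrow> nat" where
  "pp q j = (if j < 0 then 0 else (\<Sum>k\<le>nat j. q ^ k))"

definition rep :: "(nat \<Rightarrow> 'a) set \<Rightarrow> nat \<Rightarrow> 'a" where
  "rep P = (SOME v. v \<in> P)"

definition codeword :: "nat \<Rightarrow> nat \<Rightarrow> ((nat \<Rightarrow> nat) \<Rightarrow> 'a::field) \<Rightarrow> (nat \<Rightarrow> 'a) set \<Rightarrow> 'a" where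
  "codeword m d F = (\<lambda>P. if P \<in> Proj m then peval m d F (rep P) else 0)"

definition PRM :: "nat \<Rightarrow> nat \<Rightarrow> ((nat \<Rightarrow> 'a::field) set \<Rightarrow> 'a) set" where
  "PRM m d = codeword m d ` hom_polys m d"

definition code_supp :: "('b \<Rightarrow> 'a::zero) set \<Rightarrow> 'b set" where
  "code_supp D = {x. \<exists>c\<in>D. c x \<noteq> 0}"

text \<open>r-th generalized Hamming weight: minimum support size of an r-dimensional
  subspace of the code, i.e. the span of r linearly independent codewords.\<close>
definition ghw :: "('b \<Rightarrow> 'a::field) set \<Rightarrow> nat \<Rightarrow> nat" where
  "ghw C r = Min {card (code_supp {(\<lambda>x. \<Sum>j<r. a j * cs j x) | a. True}) | cs.
      (\<forall>j<r. cs j \<in> C) \<and> lin_indep r cs}"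

end

theory Submission
  imports Defs "HOL-Library.FuncSet"
begin

text \<open>
  The upper bound says that a set \<open>X\<close> of more than \<open>proj_card q k + t\<close> projective points, where
  \<open>k = m + 1 - i\<close>, imposes too many conditions on forms of degree \<open>d\<close> to be the zero set of \<open>r\<close> independent
  ones. Dimensions are measured by cardinalities of spaces of functions over the finite field.

  If \<open>\<psi>\<close> is a linear form, then the number of conditions imposed by \<open>X\<close> in degree \<open>d\<close> is at least the
  number imposed by the points of \<open>X\<close> on the hyperplane \<open>\<psi> = 0\<close> in degree \<open>d\<close> plus the number imposed by the
  remaining, affine points in degree \<open>d - 1\<close>. In affine space, slicing along coordinates, with the
  slices in decreasing order of size, shows that \<open>N\<close> points impose at least as many conditions in
  degree \<open>e\<close> as there are numbers below \<open>N\<close> whose digit sum in base \<open>q\<close> is at most \<open>e\<close>; this reduces to a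
  Clements--Lindstroem type inequality for digit sums. In projective space one picks by averaging
  a hyperplane containing sufficiently many points of \<open>X\<close> and inducts on the dimension. The induction needs a
  bound for all sizes of \<open>X\<close>, and the function \<open>cond_bound\<close> below is chosen so that the two extremal
  properties of digit sums (initial intervals have the most, final intervals the fewest small digit
  sums) make the induction step work.

  Conversely, the forms vanishing on a \<open>k - 1\<close>-dimensional subspace and on \<open>t\<close> further points have
  codimension at most the number of monomials in \<open>k\<close> variables plus \<open>t\<close>.
\<close>

subsection \<open>Digit sums\<close>

fun digsum :: "nat \<Rightarrow> nat \<Rightarrow> nat" where
  "digsum b n = (if b < 2 \<or> n = 0 then 0 else n mod b + digsum b (n div b))"

declare digsum.simps [simp del]

lemma digsum_0 [simp]: "digsum b 0 = 0"
  by (simp add: digsum.simps)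

lemma digsum_mult_add:
  assumes "2 \<le> b" "y < b"
  shows "digsum b (b * n + y) = digsum b n + y"
proof (cases "b * n + y = 0")
  case True
  with assms show ?thesis by simp
next
  case False
  with assms show ?thesis
    by (subst digsum.simps) (simp add: add.commute)
qed

lemma digsum_small: "2 \<le> b \<Longrightarrow> y < b \<Longrightarrow> digsum b y = y"
  using digsum_mult_add[of b y 0] by simp

text \<open>Without a carry the last digit grows by one; a carry turns the last digit
  \<open>b - 1\<close> into 0 and passes the step on to \<open>n div b\<close>. This supplies the
  growth condition on row weights in \<open>lexseg_minimises_weight\<close>.\<close>

lemma digsum_Suc_le:
  assumes "2 \<le> b"
  shows "digsum b (Suc n) \<le> Suc (digsum b n)"
proof (induction n rule: less_induct)
  case (less n)
  define h y where "h = n div b" and "y = n mod b"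
  have n: "n = b * h + y" and y: "y < b"
    using assms by (simp_all add: h_def y_def)
  show ?case
  proof (cases "Suc y < b")
    case True
    then show ?thesis
      using digsum_mult_add[OF assms y, of h] digsum_mult_add[OF assms True, of h] n by simp
  next
    case False
    then have "Suc n = b * Suc h + 0" using n y by simp
    then have s: "digsum b (Suc n) = digsum b (Suc h)"
      using digsum_mult_add[of b 0 "Suc h"] assms by simp
    show ?thesis
    proof (cases "n = 0")
      case True
      then show ?thesis using False n y assms by simp
    next
      case False
      then have "h < n" using assms by (simp add: h_def)
      from less.IH[OF this] show ?thesis
        using s digsum_mult_add[OF assms y, of h] n by simp
    qed
  qed
qed

text \<open>Subtraction from \<open>b ^ k - 1\<close> needs no borrowing: each of the
  \<open>k\<close> digits \<open>y\<close> becomes \<open>b - 1 - y\<close>.\<close>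

lemma digsum_complement:
  assumes "2 \<le> b" "n < b ^ k"
  shows "digsum b (b ^ k - Suc n) + digsum b n = k * (b - 1)"
  using assms(2)
proof (induction k arbitrary: n)
  case 0
  then show ?case by simp
next
  case (Suc k)
  define h y where "h = n div b" and "y = n mod b"
  have n: "n = b * h + y" and y: "y < b"
    using assms by (simp_all add: h_def y_def)
  have h: "h < b ^ k"
    using Suc.prems assms by (simp add: h_def less_mult_imp_div_less mult.commute)
  have eq: "b ^ Suc k - Suc n = b * (b ^ k - Suc h) + (b - Suc y)"
  proof -
    obtain z where z: "b ^ k = Suc h + z" using h less_iff_Suc_add by auto
    obtain w where w: "b = Suc y + w" using y less_iff_Suc_add by auto
    have "b ^ Suc k = b * h + b * z + b" by (simp add: z algebra_simps)
    then have "b ^ Suc k = Suc n + (b * z + w)" using n w by simp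
    then show ?thesis using z w by simp
  qed
  have "digsum b (b ^ Suc k - Suc n) = digsum b (b ^ k - Suc h) + (b - Suc y)"
    unfolding eq using assms y by (intro digsum_mult_add) auto
  moreover have "digsum b n = digsum b h + y"
    unfolding n using assms y by (intro digsum_mult_add) auto
  ultimately show ?case using Suc.IH[OF h] y by simp
qed

subsection \<open>Down-closed sets in a square grid\<close>

definition down_closed :: "(nat \<times> nat) set \<Rightarrow> bool" where
  "down_closed D \<longleftrightarrow> (\<forall>i h i' h'. (i, h) \<in> D \<longrightarrow> i' \<le> i \<longrightarrow> h' \<le> h \<longrightarrow> (i', h') \<in> D)"

lemma down_closedD: "down_closed D \<Longrightarrow> (i, h) \<in> D \<Longrightarrow> i' \<le> i \<Longrightarrow> h' \<le> h \<Longrightarrow> (i', h') \<in> D"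
  by (auto simp: down_closed_def)

definition level :: "(nat \<times> nat) set \<Rightarrow> nat \<Rightarrow> (nat \<times> nat) set" where
  "level D l = {p \<in> D. fst p + snd p = l}"

text \<open>The numbers below \<open>N\<close>, each split into quotient (row) and last digit
  (column). The rows below \<open>N div b\<close> are full and at most one further row is partly
  filled.\<close>

definition lexseg :: "nat \<Rightarrow> nat \<Rightarrow> (nat \<times> nat) set" where
  "lexseg b N = {p. snd p < b \<and> b * fst p + snd p < N}"

lemma lexseg_bij: "bij_betw (\<lambda>n. (n div b, n mod b)) {..<N} (lexseg b N)" if "b > 0" for b :: nat
  using that by (intro bij_betwI[where g = "\<lambda>p. b * fst p + snd p"]) (auto simp: lexseg_def)

lemma card_lexseg: "b > 0 \<Longrightarrow> card (lexseg b N) = N"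
  using bij_betw_same_card[OF lexseg_bij, of b N] by simp

lemma finite_lexseg: "b > 0 \<Longrightarrow> finite (lexseg b N)"
  using bij_betw_finite[OF lexseg_bij, of b N] by simp

lemma card_level_le:
  assumes "finite D"
  shows "card {p \<in> D. fst p + snd p \<le> E} = (\<Sum>l\<le>E. card (level D l))"
proof -
  have "{p \<in> D. fst p + snd p \<le> E} = (\<Union>l\<in>{..E}. level D l)"
    by (auto simp: level_def)
  then show ?thesis using assms
    by (simp only:) (intro card_UN_disjoint, auto simp: level_def)
qed

text \<open>Only full rows are counted: antidiagonal \<open>l\<close> meets row \<open>i\<close>
  within the \<open>b\<close> columns exactly when \<open>Suc l - b \<le> i\<close> and
  \<open>i \<le> l\<close>. The upper bound that follows also allows for the incomplete row.\<close>

lemma lexseg_level_lower: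
  assumes "b > 0"
  shows "min (Suc l) (N div b) - (Suc l - b) \<le> card (level (lexseg b N) l)"
proof -
  let ?S = "{Suc l - b..<min (Suc l) (N div b)}"
  have fin: "finite (level (lexseg b N) l)"
    using finite_lexseg[OF assms] by (simp add: level_def)
  have "(\<lambda>i. (i, l - i)) ` ?S \<subseteq> level (lexseg b N) l"
  proof
    fix p assume "p \<in> (\<lambda>i. (i, l - i)) ` ?S"
    then obtain i where i: "p = (i, l - i)" "Suc l - b \<le> i" "i \<le> l" "i < N div b" by auto
    have "l - i < b" using i assms by linarith
    moreover have "b * Suc i \<le> N"
      using i(4) assms by (metis Suc_leI div_times_less_eq_dividend le_trans mult.commute mult_le_mono1)
    ultimately show "p \<in> level (lexseg b N) l" using i by (simp add: level_def lexseg_def)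
  qed
  then have "card ((\<lambda>i. (i, l - i)) ` ?S) \<le> card (level (lexseg b N) l)"
    using fin card_mono by blast
  moreover have "card ((\<lambda>i. (i, l - i)) ` ?S) = card ?S"
    by (intro card_image) (auto simp: inj_on_def)
  ultimately show ?thesis by simp
qed

lemma lexseg_level_upper:
  assumes "b > 0"
  shows "card (level (lexseg b N) l) \<le> min (Suc l) (Suc (N div b)) - (Suc l - b)"
proof -
  let ?S = "{Suc l - b..<min (Suc l) (Suc (N div b))}"
  have "level (lexseg b N) l \<subseteq> (\<lambda>i. (i, l - i)) ` ?S"
  proof
    fix p assume p: "p \<in> level (lexseg b N) l"
    obtain i h where ih: "p = (i, h)" by force
    have "h < b" "b * i + h < N" "i + h = l" using p ih by (auto simp: level_def lexseg_def)
    then have "b * i \<le> N" by simp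
    then have "i \<le> N div b" using assms by (simp add: less_eq_div_iff_mult_less_eq mult.commute)
    then have "i \<in> ?S" "h = l - i" using \<open>h < b\<close> \<open>i + h = l\<close> by auto
    then show "p \<in> (\<lambda>i. (i, l - i)) ` ?S" using ih by auto
  qed
  then have "card (level (lexseg b N) l) \<le> card ((\<lambda>i. (i, l - i)) ` ?S)"
    by (intro card_mono) auto
  also have "\<dots> \<le> card ?S" by (rule card_image_le) simp
  finally show ?thesis by simp
qed

text \<open>A missing point \<open>(c, l - c)\<close> leaves a gap: by down-closure, antidiagonal
  \<open>Suc l\<close> has no point with first coordinate \<open>c\<close> or \<open>Suc c\<close>.
  Points before the gap lose one in the second coordinate, points after it one in the first; the
  images stay on either side of \<open>c\<close>, so the map is injective.\<close>

lemma downset_level_nonincreasing: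
  assumes fin: "finite D"
    and down: "down_closed D"
    and "card (level D l) < Suc l"
  shows "card (level D (Suc l)) \<le> card (level D l)"
proof -
  have "\<exists>c\<le>l. (c, l - c) \<notin> D"
  proof (rule ccontr)
    assume "\<not> ?thesis"
    then have "(\<lambda>c. (c, l - c)) ` {..l} \<subseteq> level D l" by (auto simp: level_def)
    then have "card ((\<lambda>c. (c, l - c)) ` {..l}) \<le> card (level D l)"
      using fin by (intro card_mono) (auto simp: level_def)
    moreover have "card ((\<lambda>c. (c, l - c)) ` {..l}) = Suc l"
      by (subst card_image) (auto simp: inj_on_def)
    ultimately show False using assms(3) by simp
  qed
  then obtain c where c: "c \<le> l" "(c, l - c) \<notin> D" by blast
  let ?f = "\<lambda>p. if fst p < c then (fst p, snd p - 1) else (fst p - 1, snd p)"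
  have key: "i < c \<or> Suc c < i" if "(i, h) \<in> level D (Suc l)" for i h
  proof (rule ccontr)
    assume "\<not> ?thesis"
    then have "c \<le> i" "l - c \<le> h" using that by (auto simp: level_def)
    then show False using that c down_closedD[OF down, of i h c "l - c"] by (auto simp: level_def)
  qed
  have "inj_on ?f (level D (Suc l))"
  proof (rule inj_onI)
    fix p p' assume *: "p \<in> level D (Suc l)" "p' \<in> level D (Suc l)" "?f p = ?f p'"
    obtain i h i' h' where ih: "p = (i, h)" "p' = (i', h')" by (metis surj_pair)
    show "p = p'"
      using * key[of i h] key[of i' h'] ih by (auto simp: level_def split: if_splits)
  qed
  moreover have "?f ` level D (Suc l) \<subseteq> level D l"
  proof (rule image_subsetI)
    fix p assume p: "p \<in> level D (Suc l)"
    obtain i h where ih: "p = (i, h)" by force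
    show "?f p \<in> level D l"
      using key[of i h] p ih down_closedD[OF down, of i h i "h - 1"] down_closedD[OF down, of i h "i - 1" h] c
      by (auto simp: level_def)
  qed
  ultimately show ?thesis
    using fin by (intro card_inj_on_le[of ?f]) (auto simp: level_def)
qed

text \<open>From antidiagonal \<open>b\<close> on, both coordinates of a point of \<open>D\<close>
  are positive, so lowering the second one is injective. The point with least first coordinate,
  lowered in that coordinate instead, yields one more point of level \<open>l\<close>.\<close>

lemma downset_level_decreasing:
  assumes sub: "D \<subseteq> {..<b} \<times> {..<b}"
    and down: "down_closed D"
    and "b \<le> Suc l"
  shows "card (level D (Suc l)) \<le> card (level D l) - 1"
proof (cases "level D (Suc l) = {}")
  case True
  then show ?thesis by simp
next
  case False
  have fin: "finite D" using sub finite_subset by blast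
  define a where "a = Min (fst ` level D (Suc l))"
  have "a \<in> fst ` level D (Suc l)"
    unfolding a_def using False fin by (intro Min_in) (auto simp: level_def)
  then obtain h where ah: "(a, h) \<in> level D (Suc l)" by auto
  have a_le: "a \<le> i" if "(i, k) \<in> level D (Suc l)" for i k
    unfolding a_def using that fin by (intro Min_le) (force simp: level_def)+
  have pos: "0 < i \<and> 0 < k" if "(i, k) \<in> level D (Suc l)" for i k
    using that sub assms(3) by (auto simp: level_def)
  let ?f = "\<lambda>p. (fst p, snd p - 1)"
  have "inj_on ?f (level D (Suc l))"
    using pos by (force simp: inj_on_def level_def)
  then have "card (level D (Suc l)) = card (?f ` level D (Suc l))" by (simp add: card_image)
  also have "\<dots> < card (insert (a - 1, h) (?f ` level D (Suc l)))"
  proof -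
    have "(a - 1, h) \<notin> ?f ` level D (Suc l)" using a_le pos[OF ah] by force
    then show ?thesis using fin by (simp add: level_def)
  qed
  also have "\<dots> \<le> card (level D l)"
  proof (rule card_mono)
    show "finite (level D l)" using fin by (simp add: level_def)
    have "(i, k - 1) \<in> level D l" if "(i, k) \<in> level D (Suc l)" for i k
      using that pos[OF that] down_closedD[OF down, of i k i "k - 1"] by (auto simp: level_def)
    moreover have "(a - 1, h) \<in> level D l"
      using ah pos[OF ah] down_closedD[OF down, of a h "a - 1" h] by (auto simp: level_def)
    ultimately show "insert (a - 1, h) (?f ` level D (Suc l)) \<subseteq> level D l" by auto
  qed
  finally show ?thesis by simp
qed

text \<open>Once a level of \<open>D\<close> is smaller than the same level of the lexicographic segment, all later
  levels of \<open>D\<close> are at most as large, so \<open>D\<close> could not catch up to the same cardinality.\<close>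

lemma lexseg_minimises_low_levels:
  assumes sub: "D \<subseteq> {..<b} \<times> {..<b}"
    and down: "down_closed D"
    and b: "b > 0"
  shows "card {p \<in> lexseg b (card D). fst p + snd p \<le> E} \<le> card {p \<in> D. fst p + snd p \<le> E}"
proof (rule ccontr)
  assume neg: "\<not> ?thesis"
  have fin: "finite D" using sub finite_subset by blast
  define R where "R = lexseg b (card D)"
  define J where "J = card D div b"
  have finR: "finite R" and cR: "card R = card D"
    using b by (simp_all add: R_def finite_lexseg card_lexseg)
  have "card D \<le> b * b" using card_mono[OF _ sub] by (simp add: card_cartesian_product)
  then have Jb: "J \<le> b" using b div_le_mono[of "card D" "b * b" b] by (simp add: J_def)
  from neg have lt: "(\<Sum>l\<le>E. card (level D l)) < (\<Sum>l\<le>E. card (level R l))"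
    using card_level_le[OF fin] card_level_le[OF finR] by (simp add: R_def)
  then obtain l where l: "l \<le> E" "card (level D l) < card (level R l)"
    by (meson atMost_iff not_le sum_mono)
  \<comment> \<open>The upper bound for the segment includes its incomplete row, so strict
    inequality at \<open>l\<close> leaves \<open>D\<close> at most the share of the full rows.
    Before the diagonal this share is bounded by the constant \<open>J\<close> and \<open>D\<close>
    does not grow; beyond it the bound falls by one per level, and a nonempty level of
    \<open>D\<close> falls at least as fast.\<close>
  have inv: "card (level D l') \<le> J - (Suc l' - b) \<and> (Suc l' < b \<longrightarrow> card (level D l') < Suc l')"
    if "l \<le> l'" for l'
    using that
  proof (induction l' rule: dec_induct)
    case base
    have "card (level D l) < min (Suc l) (Suc J) - (Suc l - b)"
      using l(2) lexseg_level_upper[OF b, of "card D" l] unfolding R_def J_def by linarith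
    then show ?case by linarith
  next
    case (step l')
    show ?case
    proof (cases "Suc l' < b")
      case True
      then show ?thesis
        using downset_level_nonincreasing[OF fin down, of l'] step.IH by linarith
    next
      case False
      then show ?thesis
        using downset_level_decreasing[OF sub down, of l'] step.IH by linarith
    qed
  qed
  have le: "card (level D l') \<le> card (level R l')" if "l \<le> l'" for l'
    using inv[OF that] lexseg_level_lower[OF b, of l' "card D"] Jb
    unfolding R_def J_def by (cases "Suc l' < b") linarith+
  obtain B where B: "\<forall>p \<in> D \<union> R. fst p + snd p \<le> B" "E \<le> B"
  proof -
    have "finite ((\<lambda>p. fst p + snd p) ` (D \<union> R))" using fin finR by simp
    then obtain B where "\<forall>p \<in> D \<union> R. fst p + snd p \<le> B"
      using finite_nat_set_iff_bounded_le by auto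
    then show ?thesis by (intro that[of "max B E"]) (auto intro: le_max_iff_disj[THEN iffD2])
  qed
  have tot: "card S = (\<Sum>l\<le>E. card (level S l)) + (\<Sum>l\<in>{E<..B}. card (level S l))"
    if "finite S" "S \<subseteq> D \<union> R" for S
  proof -
    have "S = {p \<in> S. fst p + snd p \<le> B}" using that B by auto
    then have "card S = (\<Sum>l\<le>B. card (level S l))" using card_level_le[OF that(1), of B] by simp
    also have "{..B} = {..E} \<union> {E<..B}" using B(2) by auto
    also have "(\<Sum>l\<in>{..E} \<union> {E<..B}. card (level S l)) = (\<Sum>l\<le>E. card (level S l)) + (\<Sum>l\<in>{E<..B}. card (level S l))"
      by (rule sum.union_disjoint) auto
    finally show ?thesis .
  qed
  have "(\<Sum>l\<in>{E<..B}. card (level D l)) \<le> (\<Sum>l\<in>{E<..B}. card (level R l))"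
    using l(1) by (intro sum_mono le) auto
  then show False using lt tot[OF fin] tot[OF finR] cR by simp
qed

text \<open>The hypothesis on \<open>w\<close> says that moving down one row and left one column does not increase the
  weight; as \<open>D - R\<close> has no row above a row of \<open>R - D\<close>, this reduces to the count by levels.\<close>

lemma lexseg_minimises_weight:
  assumes sub: "D \<subseteq> {..<b} \<times> {..<b}"
    and down: "down_closed D"
    and b: "b > 0"
    and w: "\<And>i. w (Suc i) \<le> Suc (w i)"
  shows "card {p \<in> lexseg b (card D). w (fst p) + snd p \<le> e} \<le> card {p \<in> D. w (fst p) + snd p \<le> e}"
proof -
  have fin: "finite D" using sub finite_subset by blast
  define R where "R = lexseg b (card D)"
  have finR: "finite R" using b by (simp add: R_def finite_lexseg)
  define W where "W = {p. w (fst p) + snd p \<le> e}"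
  have w': "w (i + k) \<le> w i + k" for i k
    by (induction k) (auto intro: order.trans[OF w])
  have "card ((R - D) \<inter> W) \<le> card ((D - R) \<inter> W)"
  proof (cases "(R - D) \<inter> W = {}")
    case True
    then show ?thesis by simp
  next
    case False
    \<comment> \<open>All of \<open>(R - D) \<inter> W\<close> lies on levels up to
      \<open>E\<close>, so the count by levels yields at least as many points of
      \<open>D - R\<close> there. It remains to see that these have small weight.\<close>
    define E where "E = Max ((\<lambda>p. fst p + snd p) ` ((R - D) \<inter> W))"
    have "E \<in> (\<lambda>p. fst p + snd p) ` ((R - D) \<inter> W)"
      unfolding E_def using False finR by (intro Max_in) auto
    then obtain i0 h0 where p0: "(i0, h0) \<in> R - D" "(i0, h0) \<in> W" "i0 + h0 = E" by auto
    let ?L = "{p. fst p + snd p \<le> E}"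
    have "(R - D) \<inter> W \<subseteq> (R - D) \<inter> ?L"
      unfolding E_def using finR by (auto intro!: Max_ge)
    then have 1: "card ((R - D) \<inter> W) \<le> card ((R - D) \<inter> ?L)"
      using finR by (intro card_mono) auto
    have "card (R \<inter> ?L) \<le> card (D \<inter> ?L)"
      using lexseg_minimises_low_levels[OF sub down b, of E] by (simp add: R_def Int_def)
    moreover have "card (R \<inter> ?L) = card (R \<inter> D \<inter> ?L) + card ((R - D) \<inter> ?L)"
      using finR by (subst card_Un_disjoint[symmetric]) (auto intro!: arg_cong[where f = card])
    moreover have "card (D \<inter> ?L) = card (R \<inter> D \<inter> ?L) + card ((D - R) \<inter> ?L)"
      using fin by (subst card_Un_disjoint[symmetric]) (auto intro!: arg_cong[where f = card])
    ultimately have 2: "card ((R - D) \<inter> ?L) \<le> card ((D - R) \<inter> ?L)" by simp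
    \<comment> \<open>Compared with \<open>(i0, h0)\<close>, such a point lies in a row
      \<open>i \<ge> i0\<close> on a level that is not higher. The weight of its row is larger by at
      most \<open>i - i0\<close>, which the smaller second coordinate compensates.\<close>
    have "(D - R) \<inter> ?L \<subseteq> (D - R) \<inter> W"
    proof
      fix p assume p: "p \<in> (D - R) \<inter> ?L"
      obtain i h where ih: "p = (i, h)" by force
      have "h < b" using p ih sub by auto
      then have ge: "card D \<le> b * i + h" using p ih by (auto simp: R_def lexseg_def)
      have lt: "b * i0 + h0 < card D" using p0 by (auto simp: R_def lexseg_def)
      have "i0 \<le> i"
      proof (rule ccontr)
        assume "\<not> ?thesis"
        then have "b * Suc i \<le> b * i0" by (intro mult_le_mono) auto
        then show False using ge lt \<open>h < b\<close> by simp
      qed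
      then obtain k where k: "i = i0 + k" using le_Suc_ex by blast
      have "w i + h \<le> e"
        using w'[of i0 k] p0 p ih k by (auto simp: W_def)
      then show "p \<in> (D - R) \<inter> W" using p ih by (auto simp: W_def)
    qed
    then have "card ((D - R) \<inter> ?L) \<le> card ((D - R) \<inter> W)"
      using fin by (intro card_mono) auto
    then show ?thesis using 1 2 by simp
  qed
  moreover have "card (R \<inter> W) = card (R \<inter> D \<inter> W) + card ((R - D) \<inter> W)"
    using finR by (subst card_Un_disjoint[symmetric]) (auto intro!: arg_cong[where f = card])
  moreover have "card (D \<inter> W) = card (R \<inter> D \<inter> W) + card ((D - R) \<inter> W)"
    using fin by (subst card_Un_disjoint[symmetric]) (auto intro!: arg_cong[where f = card])
  ultimately show ?thesis by (simp add: R_def W_def Int_def)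
qed

subsection \<open>Counting small digit sums\<close>

text \<open>The offset \<open>a\<close> records digits already split off. It is added on the left
  because for \<open>a > e\<close> the difference \<open>e - a\<close> would truncate to 0 and keep
  numbers of digit sum 0.\<close>

definition low_count :: "nat \<Rightarrow> nat \<Rightarrow> nat \<Rightarrow> nat \<Rightarrow> nat" where
  "low_count b a e N = card {n. n < N \<and> digsum b n + a \<le> e}"

lemma low_count_0 [simp]: "low_count b a e 0 = 0"
  by (simp add: low_count_def)

lemma low_count_eq_sum: "low_count b a e N = (\<Sum>n<N. of_bool (digsum b n + a \<le> e))"
  by (simp add: low_count_def sum.If_cases of_bool_def Int_def lessThan_def)

lemma low_count_Suc: "low_count b a e (Suc N) = low_count b a e N + of_bool (digsum b N + a \<le> e)"
  by (simp add: low_count_eq_sum)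

lemma low_count_add: "low_count b a e (M + N) = low_count b a e M + (\<Sum>n<N. of_bool (digsum b (M + n) + a \<le> e))"
  by (induction N) (simp_all add: low_count_Suc)

lemma low_count_mono: "M \<le> N \<Longrightarrow> low_count b a e M \<le> low_count b a e N"
  by (metis low_count_add le_Suc_ex le_add1)

lemma low_count_Lipschitz: "low_count b a e (M + N) \<le> low_count b a e M + N"
  by (induction N) (auto simp: low_count_Suc of_bool_def)

lemma low_count_offset: "low_count b (a + c) (e + c) N = low_count b a e N"
  by (simp add: low_count_def)

lemma low_count_offset_large: "e < a \<Longrightarrow> low_count b a e N = 0"
  by (simp add: low_count_def)

text \<open>From a multiple of \<open>b\<close> on, the last digit restarts at 0 in every row while
  the quotients run through \<open>C\<close>, \<open>C + 1\<close> and so on; these quotients give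
  the row weights.\<close>

lemma low_count_mult_add_digits:
  assumes "2 \<le> b"
  shows "(\<Sum>n<N. of_bool (digsum b (b * C + n) + a \<le> e)) =
    card {p \<in> lexseg b N. (digsum b (C + fst p) + a) + snd p \<le> e}"
proof -
  have "(\<Sum>n<N. of_bool (digsum b (b * C + n) + a \<le> e) :: nat) = card {n. n < N \<and> digsum b (b * C + n) + a \<le> e}"
    by (simp add: sum.If_cases of_bool_def Int_def lessThan_def)
  also have "\<dots> = card {p \<in> lexseg b N. (digsum b (C + fst p) + a) + snd p \<le> e}"
  proof (rule bij_betw_same_card[of "\<lambda>n. (n div b, n mod b)"])
    have d: "digsum b (b * C + n) = digsum b (C + n div b) + n mod b" for n
    proof -
      have "b * C + n = b * (C + n div b) + n mod b" by (simp add: algebra_simps)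
      then show ?thesis using digsum_mult_add[OF assms, of "n mod b" "C + n div b"] assms by simp
    qed
    show "bij_betw (\<lambda>n. (n div b, n mod b)) {n. n < N \<and> digsum b (b * C + n) + a \<le> e}
      {p \<in> lexseg b N. (digsum b (C + fst p) + a) + snd p \<le> e}"
      using assms d digsum_mult_add[OF assms]
      by (intro bij_betwI[where g = "\<lambda>p. b * fst p + snd p"]) (auto simp: lexseg_def add.assoc add.commute)
  qed
  finally show ?thesis .
qed

text \<open>The lexicographic segment is read by columns: column \<open>y\<close> has one entry per
  full row, and one more if the incomplete row reaches it.\<close>

lemma low_count_split_digit:
  assumes "2 \<le> b"
  shows "low_count b a e N = (\<Sum>y<b. low_count b (a + y) e (N div b + of_bool (y < N mod b)))"
proof -
  have "low_count b a e N = card {p \<in> lexseg b N. (digsum b (fst p) + a) + snd p \<le> e}"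
    using low_count_mult_add_digits[OF assms, of 0 a e N] by (simp add: low_count_eq_sum)
  also have "{p \<in> lexseg b N. (digsum b (fst p) + a) + snd p \<le> e} =
    (\<Union>y<b. (\<lambda>i. (i, y)) ` {i. i < N div b + of_bool (y < N mod b) \<and> digsum b i + (a + y) \<le> e})"
  proof -
    have "b * i + y < N \<longleftrightarrow> i < N div b + of_bool (y < N mod b)" if "y < b" for i y
    proof -
      have N: "N = b * (N div b) + N mod b" by simp
      consider "i < N div b" | "i = N div b" | "N div b < i" by linarith
      then show ?thesis
      proof cases
        case 1
        then have "b * Suc i \<le> b * (N div b)" by (intro mult_le_mono) auto
        then have "b * i + y < b * (N div b) + N mod b" using that unfolding mult_Suc_right by linarith
        then have "b * i + y < N" by simp
        then show ?thesis using 1 by simp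
      next
        case 2
        moreover have "b * (N div b) + y < N \<longleftrightarrow> y < N mod b" using N by linarith
        ultimately show ?thesis by simp
      next
        case 3
        then have "b * Suc (N div b) \<le> b * i" by (intro mult_le_mono) auto
        moreover have "N mod b < b" using assms by simp
        ultimately have "\<not> b * i + y < N" using N unfolding mult_Suc_right by linarith
        then show ?thesis using 3 by (auto simp: of_bool_def)
      qed
    qed
    then show ?thesis by (auto simp: lexseg_def algebra_simps)
  qed
  also have "card \<dots> = (\<Sum>y<b. card ((\<lambda>i. (i, y)) ` {i. i < N div b + of_bool (y < N mod b) \<and> digsum b i + (a + y) \<le> e}))"
    by (rule card_UN_disjoint) auto
  also have "\<dots> = (\<Sum>y<b. low_count b (a + y) e (N div b + of_bool (y < N mod b)))"
    unfolding low_count_def by (intro sum.cong refl card_image) (auto simp: inj_on_def)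
  finally show ?thesis .
qed

lemma sum_of_bool_less: "(\<Sum>y<b. of_bool (y < x)) = x" if "x \<le> b" for x b :: nat
proof -
  have "(\<Sum>y<b. of_bool (y < x)) = card ({..<b} \<inter> {y. y < x})"
    by (simp add: of_bool_def sum.If_cases)
  also have "{..<b} \<inter> {y. y < x} = {..<x}" using that by auto
  finally show ?thesis by simp
qed

text \<open>Splitting off the lowest digit and applying the induction hypothesis to each of its values leaves a
  two-dimensional problem whose rows are weighted by the digit sums of consecutive numbers.\<close>

lemma low_count_sum_le:
  assumes b: "2 \<le> b" and dec: "\<And>j. Suc j < b \<Longrightarrow> N (Suc j) \<le> N j"
  shows "low_count b a e (\<Sum>j<b. N j) \<le> (\<Sum>j<b. low_count b (a + j) e (N j))"
  using dec
proof (induction "N 0" arbitrary: N a rule: less_induct)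
  case less
  have mono: "N j \<le> N i" if "i \<le> j" "j < b" for i j
    using that by (induction j rule: dec_induct) (auto intro: order.trans less.prems)
  \<comment> \<open>Slices of size at most one are the base case: the sizes are \<open>t\<close>
    ones followed by zeros, and the numbers below \<open>t \<le> b\<close> are single
    digits.\<close>
  show ?case
  proof (cases "N 0 \<le> 1")
    case True
    have N1: "N j \<le> 1" if "j < b" for j using mono[of 0 j] that True by simp
    define t where "t = (\<Sum>j<b. N j)"
    have tb: "t \<le> b" using sum_mono[of "{..<b}" N "\<lambda>_. 1"] N1 by (simp add: t_def)
    have Nt: "N j = of_bool (j < t)" if "j < b" for j
    proof (cases "N j = 0")
      case True
      have "t = (\<Sum>i<j. N i)"
      proof -
        have "(\<Sum>i\<in>{..<j} \<union> {j..<b}. N i) = (\<Sum>i<j. N i) + (\<Sum>i\<in>{j..<b}. N i)"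
          by (rule sum.union_disjoint) auto
        moreover have "{..<j} \<union> {j..<b} = {..<b}" using that by auto
        ultimately have "t = (\<Sum>i<j. N i) + (\<Sum>i\<in>{j..<b}. N i)"
          by (simp only: t_def)
        moreover have "N i = 0" if "i \<in> {j..<b}" for i using mono[of j i] that True by auto
        ultimately show ?thesis by simp
      qed
      also have "\<dots> \<le> j" using sum_mono[of "{..<j}" N "\<lambda>_. 1"] N1 that by simp
      finally show ?thesis using True by simp
    next
      case False
      then have "1 \<le> N i" if "i \<le> j" for i using mono[of i j] that \<open>j < b\<close> by simp
      then have "(\<Sum>i\<le>j. 1) \<le> (\<Sum>i\<le>j. N i)" by (intro sum_mono) auto
      also have "\<dots> \<le> t" unfolding t_def using that by (intro sum_mono2) auto
      finally have "j < t" by simp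
      then show ?thesis using False N1[OF that] by simp
    qed
    have "low_count b a e t = (\<Sum>n<t. of_bool (n + a \<le> e))"
      unfolding low_count_eq_sum using tb by (intro sum.cong) (auto simp: digsum_small[OF b])
    also have "\<dots> \<le> (\<Sum>j<t. low_count b (a + j) e (N j))"
      using tb by (intro sum_mono) (auto simp: Nt low_count_Suc add.commute)
    also have "\<dots> \<le> (\<Sum>j<b. low_count b (a + j) e (N j))"
      using tb by (intro sum_mono2) auto
    finally show ?thesis by (simp add: t_def)
  next
    case False
    \<comment> \<open>\<open>M y j\<close> counts the numbers below \<open>N j\<close> with last
      digit \<open>y\<close>. For fixed \<open>y\<close> these sizes again decrease in
      \<open>j\<close>, and they sum to \<open>C + t y\<close>, where \<open>t y\<close> counts the
      slices with an additional entry in column \<open>y\<close>.\<close>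
    define c x where "c j = N j div b" and "x j = N j mod b" for j
    define M where "M y j = c j + of_bool (y < x j)" for y j
    define C t where "C = (\<Sum>j<b. c j)" and "t y = (\<Sum>j<b. of_bool (y < x j) :: nat)" for y
    have IH: "low_count b (a + y) e (C + t y) \<le> (\<Sum>j<b. low_count b (a + y + j) e (M y j))" for y
    proof -
      \<comment> \<open>Rounding \<open>N 0 / b\<close> up gives a smaller number because
        \<open>N 0\<close> exceeds 1.\<close>
      have Msmall: "M y 0 < N 0"
      proof -
        have "M y 0 \<le> N 0 div b + of_bool (0 < N 0 mod b)"
          by (auto simp: M_def c_def x_def of_bool_def)
        also have "\<dots> < N 0"
        proof (cases "N 0 div b = 0")
          case True
          then show ?thesis using False by (auto simp: of_bool_def)
        next
          case nz: False
          have "N 0 = b * (N 0 div b) + N 0 mod b" by simp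
          moreover have "2 * (N 0 div b) \<le> b * (N 0 div b)" using b by (rule mult_le_mono1)
          moreover have "of_bool (0 < N 0 mod b) \<le> N 0 mod b" by simp
          ultimately show ?thesis using nz by linarith
        qed
        finally show ?thesis .
      qed
      have Mdec: "M y (Suc j) \<le> M y j" if "Suc j < b" for j
      proof -
        have le: "N (Suc j) \<le> N j" using less.prems that .
        show ?thesis
        proof (cases "c (Suc j) = c j")
          case True
          have "N (Suc j) = b * c (Suc j) + x (Suc j)" "N j = b * c j + x j"
            by (simp_all add: c_def x_def)
          then have "x (Suc j) \<le> x j" using le True by simp
          then show ?thesis using True by (auto simp: M_def of_bool_def)
        next
          case False
          then have "c (Suc j) < c j" using le div_le_mono[OF le, of b] by (simp add: c_def)
          then show ?thesis by (auto simp: M_def of_bool_def)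
        qed
      qed
      have "(\<Sum>j<b. M y j) = C + t y" by (simp add: M_def C_def t_def sum.distrib)
      then show ?thesis using less.hyps[of "M y" "a + y", OF Msmall Mdec] by simp
    qed
    define X where "X = (\<Sum>j<b. x j)"
    have N: "(\<Sum>j<b. N j) = b * C + X"
      by (simp add: C_def X_def c_def x_def sum_distrib_left flip: sum.distrib)
    have xb: "x j < b" for j using b by (simp add: x_def)
    \<comment> \<open>The additional entries, collected by column, form a down-closed set since
      \<open>t\<close> decreases; its size is \<open>X\<close>, the sum of the remainders.\<close>
    define D where "D = {p. snd p < b \<and> fst p < t (snd p)}"
    have tb: "t y \<le> b" for y
      unfolding t_def using sum_mono[of "{..<b}" "\<lambda>j. of_bool (y < x j) :: nat" "\<lambda>_. 1"] by simp
    have tanti: "t y' \<le> t y" if "y \<le> y'" for y y'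
      unfolding t_def using that by (intro sum_mono) (auto simp: of_bool_def)
    have Dsub: "D \<subseteq> {..<b} \<times> {..<b}"
    proof
      fix p assume "p \<in> D"
      then have "snd p < b" "fst p < b" using less_le_trans[OF _ tb] by (auto simp: D_def)
      then show "p \<in> {..<b} \<times> {..<b}" by (auto simp: mem_Times_iff)
    qed
    have Ddown: "down_closed D"
      unfolding down_closed_def
    proof (intro allI impI)
      fix i h i' h' assume "(i, h) \<in> D" "i' \<le> i" "h' \<le> h"
      then show "(i', h') \<in> D" using tanti[of h' h] by (simp add: D_def)
    qed
    have DU: "{p \<in> D. P p} = (\<Union>y<b. (\<lambda>i. (i, y)) ` {i. i < t y \<and> P (i, y)})" for P
      by (auto simp: D_def)
    have cardD: "card {p \<in> D. P p} = (\<Sum>y<b. card {i. i < t y \<and> P (i, y)})" for P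
    proof -
      have "card {p \<in> D. P p} = (\<Sum>y<b. card ((\<lambda>i. (i, y)) ` {i. i < t y \<and> P (i, y)}))"
        unfolding DU by (rule card_UN_disjoint) auto
      also have "\<dots> = (\<Sum>y<b. card {i. i < t y \<and> P (i, y)})"
        by (intro sum.cong refl card_image) (auto simp: inj_on_def)
      finally show ?thesis .
    qed
    have "card D = (\<Sum>y<b. t y)" using cardD[of "\<lambda>_. True"] by simp
    also have "\<dots> = (\<Sum>j<b. \<Sum>y<b. of_bool (y < x j))"
      unfolding t_def by (rule sum.swap)
    also have "\<dots> = X" unfolding X_def using xb by (intro sum.cong refl sum_of_bool_less) (auto intro: less_imp_le)
    finally have cardDX: "card D = X" .
    define w where "w i = digsum b (C + i) + a" for i
    have w: "w (Suc i) \<le> Suc (w i)" for i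
      using digsum_Suc_le[OF b, of "C + i"] by (simp add: w_def)
    \<comment> \<open>The first \<open>b * C\<close> numbers fill columns of height
      \<open>C\<close>; the last \<open>X\<close> form a lexicographic segment on top, which is
      exchanged for \<open>D\<close>. Column \<open>y\<close> then has height
      \<open>C + t y\<close>, and the induction hypothesis applies to each column.\<close>
    have "low_count b a e (b * C + X) = low_count b a e (b * C) + card {p \<in> lexseg b X. w (fst p) + snd p \<le> e}"
      by (simp add: low_count_add low_count_mult_add_digits[OF b] w_def)
    also have "\<dots> \<le> low_count b a e (b * C) + card {p \<in> D. w (fst p) + snd p \<le> e}"
      using lexseg_minimises_weight[where w = w, OF Dsub Ddown _ w, of e] b cardDX by simp
    also have "card {p \<in> D. w (fst p) + snd p \<le> e} = (\<Sum>y<b. card {i. i < t y \<and> digsum b (C + i) + (a + y) \<le> e})"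
      by (simp add: cardD w_def add.assoc)
    also have "low_count b a e (b * C) = (\<Sum>y<b. low_count b (a + y) e C)"
      using low_count_split_digit[OF b, of a e "b * C"] b by simp
    also have "(\<Sum>y<b. low_count b (a + y) e C) + (\<Sum>y<b. card {i. i < t y \<and> digsum b (C + i) + (a + y) \<le> e})
      = (\<Sum>y<b. low_count b (a + y) e (C + t y))"
      unfolding sum.distrib[symmetric]
      by (intro sum.cong refl) (simp add: low_count_add of_bool_def sum.If_cases Int_def lessThan_def)
    also have "\<dots> \<le> (\<Sum>y<b. \<Sum>j<b. low_count b (a + y + j) e (M y j))"
      by (intro sum_mono IH)
    also have "\<dots> = (\<Sum>j<b. \<Sum>y<b. low_count b (a + j + y) e (M y j))"
      by (subst sum.swap) (simp add: ac_simps)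
    also have "\<dots> = (\<Sum>j<b. low_count b (a + j) e (N j))"
      unfolding M_def c_def x_def by (rule sum.cong[OF refl], rule low_count_split_digit[OF b, symmetric])
    finally show ?thesis by (simp add: N)
  qed
qed

text \<open>This is the slicing inequality for the sizes \<open>M\<close>, \<open>N\<close>, 0, ...,
  0 in decreasing order; dropping the offset 1 of the second slice only enlarges its count.\<close>

lemma low_count_subadd:
  assumes b: "2 \<le> b"
  shows "low_count b 0 e (M + N) \<le> low_count b 0 e M + low_count b 0 e N"
proof -
  have *: "low_count b 0 e (M + N) \<le> low_count b 0 e M + low_count b 0 e N" if "N \<le> M" for M N
  proof -
    define K where "K = (\<lambda>j::nat. if j = 0 then M else if j = 1 then N else 0)"
    obtain b' where b': "b = Suc (Suc b')" using b by (metis Suc_le_D numeral_2_eq_2 Suc_le_mono)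
    have "low_count b 0 e (\<Sum>j<b. K j) \<le> (\<Sum>j<b. low_count b (0 + j) e (K j))"
      by (rule low_count_sum_le[OF b]) (use that in \<open>auto simp: K_def\<close>)
    also have "(\<Sum>j<b. K j) = M + N"
      unfolding b' sum.lessThan_Suc_shift by (simp add: K_def)
    also have "(\<Sum>j<b. low_count b (0 + j) e (K j)) = low_count b 0 e M + low_count b 1 e N"
      unfolding b' sum.lessThan_Suc_shift by (simp add: K_def)
    also have "low_count b 1 e N \<le> low_count b 0 e N"
      unfolding low_count_def by (intro card_mono) auto
    finally show ?thesis by simp
  qed
  show ?thesis
  proof (cases "N \<le> M")
    case True
    then show ?thesis by (rule *)
  next
    case False
    then show ?thesis using *[of M N] by (simp add: add.commute)
  qed
qed

text \<open>Complementing all digits maps the numbers below \<open>N\<close> with digit sum above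
  \<open>e\<close> onto those of the last \<open>N\<close> numbers below \<open>b ^ k\<close> whose
  digit sum is at most \<open>e'\<close>. The induction adds one number at a time.\<close>

lemma low_count_complement:
  assumes b: "2 \<le> b" and "N \<le> b ^ k" and e: "e + e' + 1 = k * (b - 1)"
  shows "low_count b 0 e N + low_count b 0 e' (b ^ k) = N + low_count b 0 e' (b ^ k - N)"
  using assms(2)
proof (induction N)
  case 0
  then show ?case by simp
next
  case (Suc N)
  then have "Suc (b ^ k - Suc N) = b ^ k - N" by simp
  then have "low_count b 0 e' (b ^ k - N) = low_count b 0 e' (b ^ k - Suc N) + of_bool (digsum b (b ^ k - Suc N) \<le> e')"
    using low_count_Suc[of b 0 e' "b ^ k - Suc N"] by simp
  moreover have "digsum b (b ^ k - Suc N) \<le> e' \<longleftrightarrow> \<not> digsum b N \<le> e"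
    using digsum_complement[OF b, of N k] Suc.prems e by linarith
  ultimately show ?case using Suc by (auto simp: low_count_Suc)
qed

text \<open>Complementing every digit maps final segments to initial ones and turns this into subadditivity.\<close>

lemma low_count_interval_ge_last:
  assumes b: "2 \<le> b" and le: "M + N \<le> b ^ k"
  shows "low_count b 0 e (b ^ k) + low_count b 0 e M \<le> low_count b 0 e (M + N) + low_count b 0 e (b ^ k - N)"
proof (cases "k * (b - 1) \<le> e")
  \<comment> \<open>From the maximal digit sum on every number counts, and no complementary degree
    exists.\<close>
  case True
  have all: "low_count b 0 e K = K" if "K \<le> b ^ k" for K
  proof -
    have "{n. n < K \<and> digsum b n + 0 \<le> e} = {..<K}"
      using that True digsum_complement[OF b, of _ k]
      by (auto, metis add_leD2 le_trans less_le_trans)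
    then show ?thesis by (simp add: low_count_def)
  qed
  show ?thesis using le by (simp add: all)
next
  case False
  define e' where "e' = k * (b - 1) - e - 1"
  have e: "e' + e + 1 = k * (b - 1)" using False by (simp add: e'_def)
  have e2: "e + e' + 1 = k * (b - 1)" using e by simp
  have sub: "low_count b 0 e' (b ^ k - M) \<le> low_count b 0 e' (b ^ k - (M + N)) + low_count b 0 e' N"
    using low_count_subadd[OF b, of e' "b ^ k - (M + N)" N] le by simp
  have "low_count b 0 e M + low_count b 0 e' (b ^ k) = M + low_count b 0 e' (b ^ k - M)"
    using low_count_complement[OF b _ e2, of M] le by simp
  moreover have "low_count b 0 e (M + N) + low_count b 0 e' (b ^ k) = (M + N) + low_count b 0 e' (b ^ k - (M + N))"
    using low_count_complement[OF b _ e2, of "M + N"] le by simp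
  moreover have "low_count b 0 e' N + low_count b 0 e (b ^ k) = N + low_count b 0 e (b ^ k - N)"
    using low_count_complement[OF b _ e, of N] le by simp
  ultimately show ?thesis using sub by linarith
qed

text \<open>For \<open>e < b\<close> the limit on single digits is never felt, so the digit strings
  are the exponent vectors of the monomials in \<open>k\<close> variables of degree at most
  \<open>e\<close>.\<close>

lemma low_count_power:
  assumes b: "2 \<le> b" and "e < b"
  shows "low_count b 0 e (b ^ k) = (k + e) choose e"
  using assms(2)
proof (induction k arbitrary: e)
  case 0
  then show ?case by (simp add: low_count_Suc)
next
  case (Suc k)
  have "low_count b 0 e (b ^ Suc k) = (\<Sum>y<b. low_count b y e (b ^ k))"
    using low_count_split_digit[OF b, of 0 e "b ^ Suc k"] b by simp
  also have "\<dots> = (\<Sum>y\<le>e. low_count b y e (b ^ k))"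
    using Suc.prems by (intro sum.mono_neutral_right) (auto simp: low_count_offset_large)
  also have "\<dots> = (\<Sum>y\<le>e. (k + (e - y)) choose (e - y))"
  proof (intro sum.cong refl)
    fix y assume "y \<in> {..e}"
    then show "low_count b y e (b ^ k) = (k + (e - y)) choose (e - y)"
      using Suc.IH[of "e - y"] Suc.prems low_count_offset[of b 0 y "e - y" "b ^ k"] by simp
  qed
  also have "\<dots> = (\<Sum>y\<le>e. (k + y) choose y)"
    using sum.nat_diff_reindex[of "\<lambda>y. (k + y) choose y" "Suc e"] by (simp add: lessThan_Suc_atMost)
  also have "\<dots> = (Suc k + e) choose e" by (simp add: sum_choose_lower)
  finally show ?case .
qed

lemma low_count_initial:
  assumes "2 \<le> b" "N \<le> Suc e" "e < b"
  shows "low_count b 0 e N = N"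
proof -
  have "{n. n < N \<and> digsum b n + 0 \<le> e} = {..<N}"
    using assms by (auto simp: digsum_small)
  then show ?thesis by (simp add: low_count_def)
qed

text \<open>The leading 1 costs one unit, so \<open>b ^ k + n\<close> has digit sum
  \<open>Suc n\<close>; for \<open>n < N \<le> e\<close> it counts. For \<open>k = 0\<close> both
  summands share the last digit, which still does not overflow.\<close>

lemma low_count_after_power:
  assumes b: "2 \<le> b" and "N \<le> e" "e + 1 < b"
  shows "low_count b 0 e (b ^ k + N) = low_count b 0 e (b ^ k) + N"
proof -
  have "digsum b (b ^ k + n) = Suc n" if "Suc n < b" for n
    using that
  proof (cases k)
    case 0
    then show ?thesis using that digsum_small[OF b that] by simp
  next
    case (Suc k')
    have p: "digsum b (b ^ j) = 1" for j
    proof (induction j)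
      case 0
      then show ?case using b by (simp add: digsum_small)
    next
      case (Suc j)
      then show ?case using digsum_mult_add[OF b, of 0 "b ^ j"] b by simp
    qed
    show ?thesis using Suc that digsum_mult_add[OF b, of n "b ^ k'"] p by simp
  qed
  then show ?thesis using assms by (simp add: low_count_add)
qed

text \<open>The number of points of the projective space of a \<open>k\<close>-dimensional vector
  space; the index is the vector space dimension, so 0 stands for the empty set.\<close>

definition proj_card :: "nat \<Rightarrow> nat \<Rightarrow> nat" where
  "proj_card b k = (\<Sum>j<k. b ^ j)"

text \<open>Lower bound for the number of conditions that \<open>proj_card b k + v\<close> projective points impose on
  forms of degree \<open>Suc e\<close>.\<close>

definition cond_bound :: "nat \<Rightarrow> nat \<Rightarrow> nat \<Rightarrow> nat \<Rightarrow> nat" where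
  "cond_bound b e k v = (\<Sum>j<k. low_count b 0 e (b ^ j)) + min v (Suc e)
     + (low_count b 0 e (b ^ k) - low_count b 0 e (b ^ k - (v - Suc e)))"

text \<open>Here \<open>v'\<close> is the excess of a hyperplane section over
  \<open>proj_card b k\<close>, and \<open>N\<close> counts the points off the hyperplane. If both
  excesses reach \<open>Suc e\<close>, the comparison with final intervals suffices. Otherwise the
  terms \<open>min\<close> are balanced because one number changes \<open>low_count\<close> by at
  most 1, and just after \<open>b ^ k\<close> by exactly 1.\<close>

lemma cond_bound_step_low:
  assumes b: "2 \<le> b" and e: "e + 1 < b"
    and v': "1 \<le> v'" "v' \<le> b ^ k" and v: "1 \<le> v" "v \<le> b ^ Suc k"
    and N: "v' + N = b ^ k + v" "N \<le> b ^ Suc k"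
  shows "cond_bound b e (Suc k) v \<le> cond_bound b e k v' + low_count b 0 e N"
proof -
  let ?F = "low_count b 0 e"
  have m1: "?F (b ^ k - (v' - Suc e)) \<le> ?F (b ^ k)"
    and m2: "?F (b ^ Suc k - (v - Suc e)) \<le> ?F (b ^ Suc k)"
    by (intro low_count_mono; simp)+
  have goal: "min v (Suc e) + ?F (b ^ Suc k) + ?F (b ^ k - (v' - Suc e))
    \<le> min v' (Suc e) + ?F N + ?F (b ^ Suc k - (v - Suc e))"
  proof (cases "Suc e \<le> v'")
    case True
    show ?thesis
    proof (cases "Suc e \<le> v")
      case True': True
      have "N = (b ^ k - (v' - Suc e)) + (v - Suc e)" using N v' True True' by simp
      then show ?thesis
        using low_count_interval_ge_last[OF b, of "b ^ k - (v' - Suc e)" "v - Suc e" "Suc k" e] N(2) True True'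
        by simp
    next
      case False
      have "b ^ k - (v' - Suc e) = N + (Suc e - v)" using N v' True False by simp
      then show ?thesis
        using low_count_Lipschitz[of b 0 e N "Suc e - v"] True False by simp
    qed
  next
    case False
    show ?thesis
    proof (cases "Suc e \<le> v")
      case True
      define u where "u = Suc e - v'"
      \<comment> \<open>The hypothesis \<open>1 \<le> v'\<close> keeps \<open>u\<close> in the range
        where all numbers from \<open>b ^ k\<close> on count.\<close>
      have ue: "u \<le> e" using v' by (simp add: u_def)
      have "N = (b ^ k + u) + (v - Suc e)" using N False True by (simp add: u_def)
      then have "?F (b ^ Suc k) + ?F (b ^ k + u) \<le> ?F N + ?F (b ^ Suc k - (v - Suc e))"
        using low_count_interval_ge_last[OF b, of "b ^ k + u" "v - Suc e" "Suc k" e] N(2) by simp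
      then show ?thesis using low_count_after_power[OF b ue e, of k] False True by (simp add: u_def)
    next
      case False': False
      show ?thesis
      proof (cases "v' \<le> v")
        case True
        then have "N = b ^ k + (v - v')" using N by simp
        then show ?thesis using low_count_after_power[OF b _ e, of "v - v'" k] False False' True v' by simp
      next
        case nle: False
        then have "b ^ k = N + (v' - v)" using N by simp
        then show ?thesis using low_count_Lipschitz[of b 0 e N "v' - v"] False False' nle by simp
      qed
    qed
  qed
  show ?thesis using goal m1 m2 unfolding cond_bound_def sum.lessThan_Suc by linarith
qed

text \<open>The section keeps the index \<open>k\<close> and only its excess drops by
  \<open>N\<close>. For \<open>v'\<close> at least \<open>Suc e\<close> this is subadditivity; below
  that, the missing part of \<open>min\<close> is matched by initial numbers, all of small digit
  sum.\<close>

lemma cond_bound_step_high: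
  assumes b: "2 \<le> b" and e: "e + 1 < b" and v: "v' + N = v" "v \<le> b ^ k"
  shows "cond_bound b e k v \<le> cond_bound b e k v' + low_count b 0 e N"
proof -
  let ?F = "low_count b 0 e"
  have m1: "?F (b ^ k - (v' - Suc e)) \<le> ?F (b ^ k)"
    and m2: "?F (b ^ k - (v - Suc e)) \<le> ?F (b ^ k)"
    by (intro low_count_mono; simp)+
  have goal: "min v (Suc e) + ?F (b ^ k - (v' - Suc e))
    \<le> min v' (Suc e) + ?F N + ?F (b ^ k - (v - Suc e))"
  proof (cases "Suc e \<le> v'")
    case True
    have "b ^ k - (v' - Suc e) = (b ^ k - (v - Suc e)) + N" using v True by simp
    then show ?thesis
      using low_count_subadd[OF b, of e "b ^ k - (v - Suc e)" N] True v by simp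
  next
    case False
    show ?thesis
    proof (cases "Suc e \<le> v")
      case True
      have "N = (Suc e - v') + (v - Suc e)" using v False True by simp
      then have "?F (b ^ k) + ?F (Suc e - v') \<le> ?F N + ?F (b ^ k - (v - Suc e))"
        using low_count_interval_ge_last[OF b, of "Suc e - v'" "v - Suc e" k e] v by simp
      then show ?thesis using low_count_initial[OF b, of "Suc e - v'" e] e False True by simp
    next
      case False'': False
      then show ?thesis using low_count_initial[OF b, of N e] e v False by simp
    qed
  qed
  show ?thesis using goal m1 m2 unfolding cond_bound_def by linarith
qed

subsection \<open>Conditions imposed on forms\<close>

definition linform :: "nat \<Rightarrow> (nat \<Rightarrow> 'a::field) \<Rightarrow> (nat \<Rightarrow> 'a) \<Rightarrow> 'a" where
  "linform m a v = (\<Sum>i\<le>m. a i * v i)"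

definition lins :: "nat \<Rightarrow> ((nat \<Rightarrow> 'a::field) \<Rightarrow> 'a) set" where
  "lins m = range (linform m)"

definition forms :: "nat \<Rightarrow> nat \<Rightarrow> ((nat \<Rightarrow> 'a::field) \<Rightarrow> 'a) set" where
  "forms m d = range (peval m d)"

text \<open>Extension by zero keeps restrictions in the original function type; over a finite field
  only finitely many arise for finite \<open>X\<close>.\<close>

definition restr :: "'b set \<Rightarrow> ('b \<Rightarrow> 'a::zero) \<Rightarrow> 'b \<Rightarrow> 'a" where
  "restr X f = (\<lambda>v. if v \<in> X then f v else 0)"

text \<open>Over a field with \<open>q\<close> elements and for finite \<open>X\<close>, its
  cardinality is \<open>q\<close> to the number of independent conditions that \<open>X\<close>
  imposes on forms of degree \<open>d\<close>.\<close>

definition restr_forms :: "nat \<Rightarrow> nat \<Rightarrow> (nat \<Rightarrow> 'a::field) set \<Rightarrow> ((nat \<Rightarrow> 'a) \<Rightarrow> 'a) set" where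
  "restr_forms m d X = restr X ` forms m d"

text \<open>One notion of subspace serves vectors, forms and coefficient families alike, all being
  functions into the field.\<close>

definition lin_closed :: "('b \<Rightarrow> 'a::field) set \<Rightarrow> bool" where
  "lin_closed S \<longleftrightarrow> S \<noteq> {} \<and> (\<forall>f\<in>S. \<forall>g\<in>S. \<forall>c. (\<lambda>x. f x + c * g x) \<in> S)"

lemma lin_closedD: "lin_closed S \<Longrightarrow> f \<in> S \<Longrightarrow> g \<in> S \<Longrightarrow> (\<lambda>x. f x + c * g x) \<in> S"
  by (auto simp: lin_closed_def)

lemma lin_closed_zero: "lin_closed S \<Longrightarrow> (\<lambda>_. 0) \<in> S"
proof -
  assume S: "lin_closed S"
  then obtain f where "f \<in> S" by (auto simp: lin_closed_def)
  from lin_closedD[OF S this this, of "-1"] show ?thesis by simp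
qed

lemma lin_closed_scale: "lin_closed S \<Longrightarrow> g \<in> S \<Longrightarrow> (\<lambda>x. c * g x) \<in> S"
  using lin_closedD[OF _ lin_closed_zero, of S g c] by simp

lemma restr_eqD: "restr X f = restr X g \<Longrightarrow> v \<in> X \<Longrightarrow> f v = g v"
  by (metis restr_def)

lemma restr_eqI: "(\<And>v. v \<in> X \<Longrightarrow> f v = g v) \<Longrightarrow> restr X f = restr X g"
  by (auto simp: restr_def)

lemma lin_closed_restr:
  fixes S :: "('b \<Rightarrow> 'a::field) set"
  assumes "lin_closed S"
  shows "lin_closed (restr X ` S)"
proof -
  have "(\<lambda>x. restr X f x + c * restr X g x) = restr X (\<lambda>x. f x + c * g x)" for f g :: "'b \<Rightarrow> 'a" and c
    by (auto simp: restr_def)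
  then show ?thesis using assms by (auto simp: lin_closed_def)
qed

text \<open>The line spanned by \<open>g\<close> is a complement of the kernel: subtracting
  \<open>\<phi> f / \<phi> g\<close> times \<open>g\<close> moves any \<open>f\<close> into
  it.\<close>

lemma card_kernel_functional:
  fixes S :: "('b \<Rightarrow> 'a::{finite,field}) set"
  assumes S: "lin_closed S"
    and \<phi>: "\<And>f g c. f \<in> S \<Longrightarrow> g \<in> S \<Longrightarrow> \<phi> (\<lambda>x. f x + c * g x) = \<phi> f + c * \<phi> g"
    and g: "g \<in> S" "\<phi> g \<noteq> 0"
  shows "card S = CARD('a) * card {f \<in> S. \<phi> f = 0}"
proof -
  let ?K = "{f \<in> S. \<phi> f = 0}"
  have "bij_betw (\<lambda>(c, f). (\<lambda>x. f x + c * g x)) (UNIV \<times> ?K) S"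
  proof (rule bij_betwI[where g = "\<lambda>f. (\<phi> f / \<phi> g, \<lambda>x. f x + (- (\<phi> f / \<phi> g)) * g x)"])
    show "(\<lambda>(c, f). (\<lambda>x. f x + c * g x)) \<in> UNIV \<times> ?K \<rightarrow> S"
      using lin_closedD[OF S _ g(1)] by auto
    show "(\<lambda>f. (\<phi> f / \<phi> g, \<lambda>x. f x + (- (\<phi> f / \<phi> g)) * g x)) \<in> S \<rightarrow> UNIV \<times> ?K"
    proof
      fix f assume f: "f \<in> S"
      have "\<phi> (\<lambda>x. f x + (- (\<phi> f / \<phi> g)) * g x) = 0"
        unfolding \<phi>[OF f g(1)] using g(2) by simp
      then show "(\<phi> f / \<phi> g, \<lambda>x. f x + (- (\<phi> f / \<phi> g)) * g x) \<in> UNIV \<times> ?K"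
        using lin_closedD[OF S f g(1)] by blast
    qed
  qed (use g in \<open>auto simp: \<phi>\<close>)
  from bij_betw_same_card[OF this] show ?thesis by (simp add: card_cartesian_product)
qed

text \<open>All nonempty fibres are translates of the kernel; this is rank-nullity in multiplicative
  form.\<close>

lemma card_kernel_image:
  fixes S :: "('b \<Rightarrow> 'a::field) set" and T :: "('b \<Rightarrow> 'a) \<Rightarrow> 'c \<Rightarrow> 'a"
  assumes S: "lin_closed S" and fin: "finite S"
    and T: "\<And>f g c. f \<in> S \<Longrightarrow> g \<in> S \<Longrightarrow> T (\<lambda>x. f x + c * g x) = (\<lambda>y. T f y + c * T g y)"
  shows "card S = card (T ` S) * card {f \<in> S. T f = (\<lambda>_. 0)}"
proof -
  let ?K = "{f \<in> S. T f = (\<lambda>_. 0)}"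
  have fib: "card {f \<in> S. T f = y} = card ?K" if y: "y \<in> T ` S" for y
  proof -
    obtain f0 where f0: "f0 \<in> S" "T f0 = y" using y by auto
    have "bij_betw (\<lambda>f x. f x + (-1) * f0 x) {f \<in> S. T f = y} ?K"
    proof (rule bij_betwI[where g = "\<lambda>f x. f x + 1 * f0 x"])
      show "(\<lambda>f x. f x + (-1) * f0 x) \<in> {f \<in> S. T f = y} \<rightarrow> ?K"
      proof
        fix f assume "f \<in> {f \<in> S. T f = y}"
        then show "(\<lambda>x. f x + (-1) * f0 x) \<in> ?K"
          using T[of f f0 "-1"] lin_closedD[OF S, of f f0 "-1"] f0 by auto
      qed
      show "(\<lambda>f x. f x + 1 * f0 x) \<in> ?K \<rightarrow> {f \<in> S. T f = y}"
      proof
        fix f assume "f \<in> ?K"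
        then show "(\<lambda>x. f x + 1 * f0 x) \<in> {f \<in> S. T f = y}"
          using T[of f f0 "1"] lin_closedD[OF S, of f f0 "1"] f0 by auto
      qed
    qed auto
    then show ?thesis by (rule bij_betw_same_card)
  qed
  have "S = (\<Union>y\<in>T ` S. {f \<in> S. T f = y})" by auto
  then have "card S = card (\<Union>y\<in>T ` S. {f \<in> S. T f = y})" by simp
  also have "\<dots> = (\<Sum>y\<in>T ` S. card {f \<in> S. T f = y})"
    using fin by (intro card_UN_disjoint) auto
  also have "\<dots> = card (T ` S) * card ?K" using fib by simp
  finally show ?thesis .
qed

lemma finite_functions_zero_outside:
  "finite X \<Longrightarrow> finite {f :: 'b \<Rightarrow> 'a::{finite,zero}. \<forall>x. x \<notin> X \<longrightarrow> f x = 0}"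
  using finite_set_of_finite_funs[of X "UNIV :: 'a set" 0] by simp

lemma card_functions_zero_outside:
  assumes "finite X"
  shows "card {f :: 'b \<Rightarrow> 'a::{finite,zero}. \<forall>x. x \<notin> X \<longrightarrow> f x = 0} = CARD('a) ^ card X"
proof -
  have "card {f :: 'b \<Rightarrow> 'a. \<forall>x. x \<notin> X \<longrightarrow> f x = 0} = card (X \<rightarrow>\<^sub>E (UNIV :: 'a set))"
  proof (rule bij_betw_same_card[of "\<lambda>f. restrict f X"])
    show "bij_betw (\<lambda>f. restrict f X) {f :: 'b \<Rightarrow> 'a. \<forall>x. x \<notin> X \<longrightarrow> f x = 0} (X \<rightarrow>\<^sub>E (UNIV :: 'a set))"
      by (rule bij_betwI[where g = "restr X"])
        (auto simp: restr_def fun_eq_iff PiE_def extensional_def)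
  qed
  then show ?thesis using assms by (simp add: card_PiE)
qed

lemma finite_restr_image:
  fixes S :: "('b \<Rightarrow> 'a::{finite,zero}) set"
  shows "finite X \<Longrightarrow> finite (restr X ` S)"
  by (rule finite_subset[OF _ finite_functions_zero_outside]) (auto simp: restr_def)

lemma finite_restr_forms: "finite X \<Longrightarrow> finite (restr_forms m d (X :: (nat \<Rightarrow> 'a::{finite,field}) set))"
  by (simp add: restr_forms_def finite_restr_image)

section \<open>Algebra of homogeneous and linear forms\<close>

lemma finite_mon_exps: "finite (mon_exps m d)"
proof (rule finite_subset)
  have "\<alpha> i \<le> d" if "(\<Sum>i\<le>m. \<alpha> i) = d" "i \<le> m" for \<alpha> :: "nat \<Rightarrow> nat" and i
    using that member_le_sum[of i "{..m}" \<alpha>] by simp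
  then show "mon_exps m d \<subseteq> {f. \<forall>x. (x \<in> {..m} \<longrightarrow> f x \<in> {..d}) \<and> (x \<notin> {..m} \<longrightarrow> f x = 0)}"
    by (auto simp: mon_exps_def)
  show "finite {f. \<forall>x. (x \<in> {..m} \<longrightarrow> f x \<in> {..d}) \<and> (x \<notin> {..m} \<longrightarrow> f x = (0::nat))}"
    by (rule finite_set_of_finite_funs) auto
qed

lemma peval_add_scale:
  "peval m d (\<lambda>\<alpha>. F \<alpha> + c * G \<alpha>) = (\<lambda>v. peval m d F v + c * peval m d G v)"
  by (simp add: fun_eq_iff peval_def sum.distrib sum_distrib_left algebra_simps)

lemma lin_closed_forms: "lin_closed (forms m d)"
  unfolding lin_closed_def forms_def using peval_add_scale[of m d, symmetric] by fastforce

lemma linform_add_scale: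
  "linform m (\<lambda>i. a i + c * b i) = (\<lambda>v. linform m a v + c * linform m b v)"
  by (simp add: fun_eq_iff linform_def sum.distrib sum_distrib_left algebra_simps)

lemma lin_closed_lins: "lin_closed (lins m)"
  unfolding lin_closed_def lins_def using linform_add_scale[of m, symmetric] by fastforce

lemma lins_linear:
  "\<psi> \<in> lins m \<Longrightarrow> \<psi> (\<lambda>i. v i + c * w i) = \<psi> v + c * \<psi> w"
  by (auto simp: lins_def linform_def sum.distrib sum_distrib_left algebra_simps)

lemma coordinate_in_lins:
  assumes "k \<le> m"
  shows "(\<lambda>v. v k) \<in> (lins m :: ((nat \<Rightarrow> 'a::field) \<Rightarrow> 'a) set)"
proof -
  have "(\<lambda>v :: nat \<Rightarrow> 'a. v k) = linform m (\<lambda>i. if i = k then 1 else 0)"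
    using assms by (auto simp: linform_def if_distrib[of "\<lambda>x. x * _"] cong: if_cong)
  then show ?thesis unfolding lins_def by (metis rangeI)
qed

lemma one_in_forms: "(\<lambda>_. 1) \<in> (forms m 0 :: ((nat \<Rightarrow> 'a::field) \<Rightarrow> 'a) set)"
proof -
  have "mon_exps m 0 = {\<lambda>_. 0}"
    by (auto simp: mon_exps_def fun_eq_iff) (metis atMost_iff not_le)
  then have "(\<lambda>_. 1) = (peval m 0 (\<lambda>_. 1) :: (nat \<Rightarrow> 'a) \<Rightarrow> 'a)"
    by (simp add: peval_def fun_eq_iff)
  then show ?thesis unfolding forms_def by (metis rangeI)
qed

lemma forms_mult_coordinate:
  assumes "k \<le> m" "f \<in> forms m d"
  shows "(\<lambda>v. v k * f v) \<in> forms m (Suc d)"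
proof -
  obtain F where F: "f = peval m d F" using assms by (auto simp: forms_def)
  \<comment> \<open>Each coefficient moves to the exponent raised by one at \<open>k\<close>;
    monomials without that variable get 0.\<close>
  define G where "G \<beta> = (if \<beta> k > 0 then F (\<beta>(k := \<beta> k - 1)) else 0)" for \<beta> :: "nat \<Rightarrow> nat"
  have "peval m (Suc d) G v = v k * peval m d F v" for v
  proof -
    let ?M = "\<lambda>\<alpha>. \<Prod>i\<le>m. v i ^ \<alpha> i"
    have prod: "?M (\<alpha>(k := Suc (\<alpha> k))) = v k * ?M \<alpha>" for \<alpha>
    proof -
      have "?M (\<alpha>(k := Suc (\<alpha> k))) = v k ^ Suc (\<alpha> k) * (\<Prod>i\<in>{..m} - {k}. v i ^ (\<alpha>(k := Suc (\<alpha> k))) i)"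
        using assms by (subst prod.remove[of _ k]) auto
      also have "(\<Prod>i\<in>{..m} - {k}. v i ^ (\<alpha>(k := Suc (\<alpha> k))) i) = (\<Prod>i\<in>{..m} - {k}. v i ^ \<alpha> i)"
        by (rule prod.cong) auto
      also have "v k ^ Suc (\<alpha> k) * (\<Prod>i\<in>{..m} - {k}. v i ^ \<alpha> i) = v k * ?M \<alpha>"
        using assms by (subst prod.remove[of "{..m}" k]) (auto simp: mult.assoc)
      finally show ?thesis .
    qed
    have sums: "(\<Sum>i\<le>m. (\<alpha>(k := x)) i) + \<alpha> k = (\<Sum>i\<le>m. \<alpha> i) + x" for \<alpha> :: "nat \<Rightarrow> nat" and x
    proof -
      have "(\<Sum>i\<le>m. (\<alpha>(k := x)) i) = x + (\<Sum>i\<in>{..m} - {k}. (\<alpha>(k := x)) i)"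
        using assms by (subst sum.remove[of _ k]) auto
      also have "(\<Sum>i\<in>{..m} - {k}. (\<alpha>(k := x)) i) = (\<Sum>i\<in>{..m} - {k}. \<alpha> i)"
        by (rule sum.cong) auto
      finally show ?thesis using assms sum.remove[of "{..m}" k \<alpha>] by simp
    qed
    have "peval m (Suc d) G v = (\<Sum>\<beta>\<in>{\<beta> \<in> mon_exps m (Suc d). \<beta> k > 0}. G \<beta> * ?M \<beta>)"
      unfolding peval_def using finite_mon_exps by (intro sum.mono_neutral_right) (auto simp: G_def)
    also have "\<dots> = (\<Sum>\<alpha>\<in>mon_exps m d. F \<alpha> * (v k * ?M \<alpha>))"
    proof (rule sum.reindex_bij_witness[where i = "\<lambda>\<alpha>. \<alpha>(k := Suc (\<alpha> k))" and j = "\<lambda>\<beta>. \<beta>(k := \<beta> k - 1)"])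
      fix \<beta> assume \<beta>: "\<beta> \<in> {\<beta> \<in> mon_exps m (Suc d). \<beta> k > 0}"
      show up: "(\<beta>(k := \<beta> k - 1))(k := Suc ((\<beta>(k := \<beta> k - 1)) k)) = \<beta>" using \<beta> by auto
      show "\<beta>(k := \<beta> k - 1) \<in> mon_exps m d"
        using \<beta> assms sums[of \<beta> "\<beta> k - 1"] by (auto simp: mon_exps_def)
      show "F (\<beta>(k := \<beta> k - 1)) * (v k * ?M (\<beta>(k := \<beta> k - 1))) = G \<beta> * ?M \<beta>"
        using prod[of "\<beta>(k := \<beta> k - 1)", unfolded up] \<beta> by (simp only: G_def) simp
    next
      fix \<alpha> assume \<alpha>: "\<alpha> \<in> mon_exps m d"
      show "(\<alpha>(k := Suc (\<alpha> k)))(k := (\<alpha>(k := Suc (\<alpha> k))) k - 1) = \<alpha>" by auto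
      show "\<alpha>(k := Suc (\<alpha> k)) \<in> {\<beta> \<in> mon_exps m (Suc d). \<beta> k > 0}"
        using \<alpha> assms sums[of \<alpha> "Suc (\<alpha> k)"] by (auto simp: mon_exps_def)
    qed
    also have "\<dots> = v k * peval m d F v"
      by (simp add: peval_def sum_distrib_left algebra_simps)
    finally show ?thesis .
  qed
  then have "(\<lambda>v. v k * f v) = peval m (Suc d) G" using F by auto
  then show ?thesis by (simp add: forms_def)
qed

lemma forms_mult_lins:
  assumes "\<psi> \<in> lins m" "f \<in> forms m d"
  shows "(\<lambda>v. \<psi> v * f v) \<in> forms m (Suc d)"
proof -
  obtain a where a: "\<psi> = linform m a" using assms by (auto simp: lins_def)
  have "(\<lambda>v. (\<Sum>i\<in>S. a i * v i) * f v) \<in> forms m (Suc d)" if "finite S" "S \<subseteq> {..m}" for S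
    using that
  proof (induction S)
    case empty
    then show ?case using lin_closed_zero[OF lin_closed_forms] by simp
  next
    case (insert i S)
    have "(\<lambda>v. (\<Sum>i\<in>S. a i * v i) * f v + a i * (v i * f v)) \<in> forms m (Suc d)"
      using insert forms_mult_coordinate[OF _ assms(2), of i]
      by (intro lin_closedD[OF lin_closed_forms]) auto
    then show ?case using insert by (simp add: algebra_simps)
  qed
  then show ?thesis unfolding a linform_def by blast
qed

lemma forms_homogeneous:
  assumes "f \<in> forms m d"
  shows "f (\<lambda>i. c * v i) = c ^ d * f v"
proof -
  obtain F where F: "f = peval m d F" using assms by (auto simp: forms_def)
  have "(\<Prod>i\<le>m. (c * v i) ^ \<alpha> i) = c ^ d * (\<Prod>i\<le>m. v i ^ \<alpha> i)" if "\<alpha> \<in> mon_exps m d" for \<alpha>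
  proof -
    have "(\<Prod>i\<le>m. c ^ \<alpha> i) = c ^ d" using that by (simp add: mon_exps_def flip: power_sum)
    then show ?thesis by (simp add: power_mult_distrib prod.distrib)
  qed
  then show ?thesis unfolding F peval_def by (simp add: sum_distrib_left algebra_simps)
qed

section \<open>Hyperplane sections and affine point sets\<close>

lemma card_restr_forms_mono:
  fixes X :: "(nat \<Rightarrow> 'a::{finite,field}) set"
  assumes "finite X" "Y \<subseteq> X"
  shows "card (restr_forms m d Y) \<le> card (restr_forms m d X)"
proof -
  have "restr_forms m d Y = restr Y ` restr_forms m d X"
    unfolding restr_forms_def image_image using assms by (intro image_cong refl) (auto simp: restr_def fun_eq_iff)
  then show ?thesis using finite_restr_forms[OF assms(1)] by (simp add: card_image_le)
qed

text \<open>A form on the hyperplane \<open>\<psi> = 0\<close> can be lifted and then corrected by any multiple of \<open>\<psi>\<close>.\<close>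

lemma card_restr_forms_hyperplane:
  fixes X :: "(nat \<Rightarrow> 'a::{finite,field}) set"
  assumes fin: "finite X" and l: "\<psi> \<in> lins m"
  shows "card (restr_forms m (Suc d) {v \<in> X. \<psi> v = 0}) * card (restr_forms m d {v \<in> X. \<psi> v \<noteq> 0}) \<le> card (restr_forms m (Suc d) X)"
proof -
  let ?A = "{v \<in> X. \<psi> v = 0}" and ?B = "{v \<in> X. \<psi> v \<noteq> 0}"
  define G where "G g = (SOME f. f \<in> forms m (Suc d) \<and> restr ?A f = g)" for g
  define H where "H h = (SOME f. f \<in> forms m d \<and> restr ?B f = h)" for h
  have G: "G g \<in> forms m (Suc d) \<and> restr ?A (G g) = g" if "g \<in> restr_forms m (Suc d) ?A" for g
  proof -
    have "\<exists>f. f \<in> forms m (Suc d) \<and> restr ?A f = g" using that by (auto simp: restr_forms_def)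
    from someI_ex[OF this] show ?thesis by (simp add: G_def)
  qed
  have H: "H h \<in> forms m d \<and> restr ?B (H h) = h" if "h \<in> restr_forms m d ?B" for h
  proof -
    have "\<exists>f. f \<in> forms m d \<and> restr ?B f = h" using that by (auto simp: restr_forms_def)
    from someI_ex[OF this] show ?thesis by (simp add: H_def)
  qed
  \<comment> \<open>On \<open>?A\<close> the correction vanishes, so the sum determines
    \<open>g\<close> and with it the lift \<open>G g\<close>; on \<open>?B\<close> division by
    \<open>\<psi>\<close> then recovers \<open>h\<close>.\<close>
  define \<Phi> where "\<Phi> = (\<lambda>(g, h). restr X (\<lambda>v. G g v + 1 * (\<psi> v * H h v)))"
  have "inj_on \<Phi> (restr_forms m (Suc d) ?A \<times> restr_forms m d ?B)"
  proof (rule inj_onI, clarify)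
    fix g h g' h'
    assume *: "g \<in> restr_forms m (Suc d) ?A" "h \<in> restr_forms m d ?B" "g' \<in> restr_forms m (Suc d) ?A" "h' \<in> restr_forms m d ?B"
      and "\<Phi> (g, h) = \<Phi> (g', h')"
    then have eq: "G g v + \<psi> v * H h v = G g' v + \<psi> v * H h' v" if "v \<in> X" for v
      using restr_eqD[of X "\<lambda>v. G g v + \<psi> v * H h v" "\<lambda>v. G g' v + \<psi> v * H h' v" v] that
      by (simp add: \<Phi>_def)
    have "restr ?A (G g) = restr ?A (G g')"
      by (rule restr_eqI) (use eq in force)
    then have gg: "g = g'" using G[OF *(1)] G[OF *(3)] by simp
    have "restr ?B (H h) = restr ?B (H h')"
      by (rule restr_eqI) (use eq gg in force)
    then have "h = h'" using H[OF *(2)] H[OF *(4)] by simp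
    with gg show "g = g' \<and> h = h'" by simp
  qed
  moreover have "\<Phi> ` (restr_forms m (Suc d) ?A \<times> restr_forms m d ?B) \<subseteq> restr_forms m (Suc d) X"
  proof (rule image_subsetI, clarify)
    fix g h assume *: "g \<in> restr_forms m (Suc d) ?A" "h \<in> restr_forms m d ?B"
    have "G g \<in> forms m (Suc d)" "(\<lambda>v. \<psi> v * H h v) \<in> forms m (Suc d)"
      using G[OF *(1)] H[OF *(2)] forms_mult_lins[OF l] by blast+
    then have "(\<lambda>v. G g v + 1 * (\<psi> v * H h v)) \<in> forms m (Suc d)"
      by (rule lin_closedD[OF lin_closed_forms])
    then show "\<Phi> (g, h) \<in> restr_forms m (Suc d) X" unfolding \<Phi>_def restr_forms_def prod.case by (rule imageI)
  qed
  ultimately have "card (restr_forms m (Suc d) ?A \<times> restr_forms m d ?B) \<le> card (restr_forms m (Suc d) X)"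
    using finite_restr_forms[OF fin] by (intro card_inj_on_le)
  then show ?thesis by (simp add: card_cartesian_product)
qed

lemma card_restr_forms_pos: "finite X \<Longrightarrow> 1 \<le> card (restr_forms m d (X :: (nat \<Rightarrow> 'a::{finite,field}) set))"
  using finite_restr_forms[of X m d] by (simp add: restr_forms_def forms_def Suc_le_eq card_gt_0_iff)

lemma lins_power_in_forms: "\<psi> \<in> lins m \<Longrightarrow> (\<lambda>v. \<psi> v ^ d) \<in> forms m d"
proof (induction d)
  case 0
  then show ?case by (simp add: one_in_forms)
next
  case (Suc d)
  then show ?case using forms_mult_lins[of \<psi> m "\<lambda>v. \<psi> v ^ d" d] by simp
qed

text \<open>The multiples of the \<open>d\<close>-th power of \<open>\<psi>\<close> already take
  every value at \<open>v\<close>.\<close>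

lemma card_restr_forms_point:
  fixes v :: "nat \<Rightarrow> 'a::{finite,field}"
  assumes l: "\<psi> \<in> lins m" and v: "\<psi> v \<noteq> 0"
  shows "CARD('a) \<le> card (restr_forms m d {v})"
proof (rule card_inj_on_le[where f = "\<lambda>c. restr {v} (\<lambda>w. c * \<psi> w ^ d)"])
  show "finite (restr_forms m d {v})" by (simp add: finite_restr_forms)
  show "range (\<lambda>c. restr {v} (\<lambda>w. c * \<psi> w ^ d)) \<subseteq> restr_forms m d {v}"
    using lin_closed_scale[OF lin_closed_forms lins_power_in_forms[OF l]] by (auto simp: restr_forms_def)
  show "inj (\<lambda>c. restr {v} (\<lambda>w. c * \<psi> w ^ d))"
  proof (rule injI)
    fix c c' assume "restr {v} (\<lambda>w. c * \<psi> w ^ d) = restr {v} (\<lambda>w. c' * \<psi> w ^ d)"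
    from restr_eqD[OF this, of v] show "c = c'" using v by simp
  qed
qed

text \<open>A slice is the section by the hyperplane where coordinate \<open>k\<close> equals
  \<open>c\<close> times \<open>\<psi>\<close>. Each slice removed costs the rest one degree, whence
  the offset \<open>j\<close> of the slice at position \<open>j\<close>.\<close>

lemma card_restr_forms_slices:
  fixes Y :: "(nat \<Rightarrow> 'a::{finite,field}) set"
  assumes l: "\<psi> \<in> lins m" and k: "k \<le> m" and "distinct cs" "finite Y"
    and "\<And>v. v \<in> Y \<Longrightarrow> \<psi> v \<noteq> 0 \<and> v k / \<psi> v \<in> set cs"
    and "\<And>c e. CARD('a) ^ low_count CARD('a) 0 e (card {v \<in> Y. v k / \<psi> v = c}) \<le> card (restr_forms m e {v \<in> Y. v k / \<psi> v = c})"
  shows "CARD('a) ^ (\<Sum>j<length cs. low_count CARD('a) j e (card {v \<in> Y. v k / \<psi> v = cs ! j})) \<le> card (restr_forms m e Y)"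
  using assms(3-)
proof (induction cs arbitrary: Y e)
  case Nil
  then show ?case using card_restr_forms_pos[of Y m e] by simp
next
  case (Cons c cs)
  let ?q = "CARD('a)"
  define \<psi>' where "\<psi>' = (\<lambda>v. v k + (- c) * \<psi> v)"
  have l': "\<psi>' \<in> lins m"
    unfolding \<psi>'_def by (rule lin_closedD[OF lin_closed_lins coordinate_in_lins[OF k] l])
  have z: "\<psi>' v = 0 \<longleftrightarrow> v k / \<psi> v = c" if "v \<in> Y" for v
    using Cons.prems(3)[OF that] by (auto simp: \<psi>'_def field_simps)
  let ?A = "{v \<in> Y. v k / \<psi> v = c}" and ?B = "{v \<in> Y. v k / \<psi> v \<noteq> c}"
  have sl: "{v \<in> ?B. v k / \<psi> v = x} = (if x = c then {} else {v \<in> Y. v k / \<psi> v = x})" for x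
    by auto
  have split: "(\<Sum>j<length (c # cs). low_count ?q j e (card {v \<in> Y. v k / \<psi> v = (c # cs) ! j}))
     = low_count ?q 0 e (card ?A) + (\<Sum>j<length cs. low_count ?q (Suc j) e (card {v \<in> Y. v k / \<psi> v = cs ! j}))"
    by (simp add: sum.lessThan_Suc_shift del: sum.lessThan_Suc)
  show ?case
  proof (cases e)
    \<comment> \<open>In degree 0 only the first slice can contribute: all later offsets exceed the
      degree.\<close>
    case 0
    have "card (restr_forms m e ?A) \<le> card (restr_forms m e Y)"
      using Cons.prems by (intro card_restr_forms_mono) auto
    moreover have "(\<Sum>j<length cs. low_count ?q (Suc j) e (card {v \<in> Y. v k / \<psi> v = cs ! j})) = 0"
      using 0 by (simp add: low_count_offset_large)
    ultimately show ?thesis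
      unfolding split using Cons.prems(4)[of e c] by simp
  next
    case (Suc e')
    have "?q ^ (\<Sum>j<length cs. low_count ?q j e' (card {v \<in> ?B. v k / \<psi> v = cs ! j})) \<le> card (restr_forms m e' ?B)"
    proof (rule Cons.IH)
      show "?q ^ low_count ?q 0 e (card {v \<in> ?B. v k / \<psi> v = x}) \<le> card (restr_forms m e {v \<in> ?B. v k / \<psi> v = x})" for x e
        unfolding sl using Cons.prems(4)[of e x] card_restr_forms_pos[of "{} :: (nat \<Rightarrow> 'a) set" m e] by simp
    qed (use Cons.prems in auto)
    also have "(\<Sum>j<length cs. low_count ?q j e' (card {v \<in> ?B. v k / \<psi> v = cs ! j}))
      = (\<Sum>j<length cs. low_count ?q (Suc j) e (card {v \<in> Y. v k / \<psi> v = cs ! j}))"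
    proof (intro sum.cong refl)
      fix j assume "j \<in> {..<length cs}"
      then have "cs ! j \<noteq> c" using Cons.prems(1) by auto
      then show "low_count ?q j e' (card {v \<in> ?B. v k / \<psi> v = cs ! j}) = low_count ?q (Suc j) e (card {v \<in> Y. v k / \<psi> v = cs ! j})"
        unfolding sl using Suc low_count_offset[of ?q j 1 e'] by simp
    qed
    finally have B: "?q ^ (\<Sum>j<length cs. low_count ?q (Suc j) e (card {v \<in> Y. v k / \<psi> v = cs ! j})) \<le> card (restr_forms m e' ?B)" .
    have "{v \<in> Y. \<psi>' v = 0} = ?A" "{v \<in> Y. \<psi>' v \<noteq> 0} = ?B" using z by auto
    then have "card (restr_forms m e ?A) * card (restr_forms m e' ?B) \<le> card (restr_forms m e Y)"
      using card_restr_forms_hyperplane[OF Cons.prems(2) l', of e'] Suc by simp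
    then show ?thesis
      unfolding split power_add using mult_le_mono[OF Cons.prems(4)[of e c] B] by linarith
  qed
qed

text \<open>Where \<open>\<psi>\<close> is nonzero, the quotients \<open>v i / \<psi> v\<close> are
  affine coordinates; the last hypothesis says that they separate the points of
  \<open>Y\<close>.\<close>

lemma card_restr_forms_affine:
  fixes Y :: "(nat \<Rightarrow> 'a::{finite,field}) set"
  assumes l: "\<psi> \<in> lins m" and Y: "finite Y" "Y \<subseteq> pvecs m" "\<And>v. v \<in> Y \<Longrightarrow> \<psi> v \<noteq> 0"
    and inj: "\<And>v w. v \<in> Y \<Longrightarrow> w \<in> Y \<Longrightarrow> (\<And>i. v i / \<psi> v = w i / \<psi> w) \<Longrightarrow> v = w"
  shows "CARD('a) ^ low_count CARD('a) 0 e (card Y) \<le> card (restr_forms m e Y)"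
proof -
  let ?q = "CARD('a)"
  have q2: "2 \<le> ?q"
    using card_mono[of "UNIV :: 'a set" "{0, 1}"] by simp
  \<comment> \<open>The induction is on the number \<open>n\<close> of coordinates that may still
    vary; for \<open>n = 0\<close> at most one point is left.\<close>
  have main: "?q ^ low_count ?q 0 e (card Y) \<le> card (restr_forms m e Y)"
    if "n \<le> Suc m" "finite Y" "\<And>v. v \<in> Y \<Longrightarrow> \<psi> v \<noteq> 0"
      "\<And>v w. v \<in> Y \<Longrightarrow> w \<in> Y \<Longrightarrow> (\<And>i. v i / \<psi> v = w i / \<psi> w) \<Longrightarrow> v = w"
      "\<And>v w i. v \<in> Y \<Longrightarrow> w \<in> Y \<Longrightarrow> n \<le> i \<Longrightarrow> v i / \<psi> v = w i / \<psi> w" for n e Y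
    using that
  proof (induction n arbitrary: Y e)
    case 0
    show ?case
    proof (cases "Y = {}")
      case True
      then show ?thesis using card_restr_forms_pos[of "{} :: (nat \<Rightarrow> 'a) set" m e] by simp
    next
      case False
      then obtain v where v: "v \<in> Y" by auto
      have "w = v" if "w \<in> Y" for w
        by (rule 0(4)[OF that v], rule 0(5)[OF that v], simp)
      then have "Y = {v}" using v by blast
      then show ?thesis using card_restr_forms_point[OF l 0(3)[OF v]] by (simp add: low_count_Suc)
    qed
  next
    case (Suc n)
    obtain xs :: "'a list" where xs: "set xs = UNIV" "distinct xs"
      using finite_distinct_list[of "UNIV :: 'a set"] by auto
    define N where "N c = card {v \<in> Y. v n / \<psi> v = c}" for c
    \<comment> \<open>\<open>low_count_sum_le\<close> needs decreasing slice sizes, so the field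
      elements are ordered by the size of their slice.\<close>
    define cs where "cs = rev (sort_key N xs)"
    have cs: "set cs = UNIV" "distinct cs" using xs by (simp_all add: cs_def)
    then have len: "length cs = ?q" by (metis distinct_card)
    have IH: "?q ^ low_count ?q 0 e (card {v \<in> Y. v n / \<psi> v = c}) \<le> card (restr_forms m e {v \<in> Y. v n / \<psi> v = c})" for c e
    proof (rule Suc.IH)
      fix v w i assume "v \<in> {v \<in> Y. v n / \<psi> v = c}" "w \<in> {v \<in> Y. v n / \<psi> v = c}" "n \<le> i"
      then show "v i / \<psi> v = w i / \<psi> w"
        using Suc.prems(5)[of v w i] by (cases "i = n") auto
    next
      fix v w assume "v \<in> {v \<in> Y. v n / \<psi> v = c}" "w \<in> {v \<in> Y. v n / \<psi> v = c}"
        "\<And>i. v i / \<psi> v = w i / \<psi> w"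
      then show "v = w" using Suc.prems(4)[of v w] by blast
    qed (use Suc.prems(1-3) in auto)
    have sorted: "N (cs ! Suc j) \<le> N (cs ! j)" if "Suc j < ?q" for j
    proof -
      have "sorted (rev (map N cs))" by (simp add: cs_def rev_map)
      from sorted_rev_nth_mono[OF this, of j "Suc j"] show ?thesis using that len by simp
    qed
    have "card Y = (\<Sum>c\<in>UNIV. N c)"
    proof -
      have "card Y = card (\<Union>c. {v \<in> Y. v n / \<psi> v = c})"
        by (rule arg_cong[where f = card]) auto
      also have "\<dots> = (\<Sum>c\<in>UNIV. N c)" unfolding N_def
        using Suc.prems(2) by (intro card_UN_disjoint) auto
      finally show ?thesis .
    qed
    also have "\<dots> = (\<Sum>j<?q. N (cs ! j))"
      using sum.reindex_bij_betw[OF bij_betw_nth[OF cs(2) refl cs(1)[symmetric]], of N] len by simp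
    finally have "low_count ?q 0 e (card Y) \<le> (\<Sum>j<?q. low_count ?q (0 + j) e (N (cs ! j)))"
      using low_count_sum_le[OF q2, of "\<lambda>j. N (cs ! j)" 0 e] sorted by simp
    then have "?q ^ low_count ?q 0 e (card Y) \<le> ?q ^ (\<Sum>j<length cs. low_count ?q j e (N (cs ! j)))"
      using q2 len by (intro power_increasing) auto
    also have "\<dots> \<le> card (restr_forms m e Y)" unfolding N_def
      by (rule card_restr_forms_slices[OF l _ cs(2) Suc.prems(2) _ IH]) (use Suc.prems(1,3) cs in auto)
    finally show ?case .
  qed
  show ?thesis
  proof (rule main[of "Suc m"])
    fix v w i assume "v \<in> Y" "w \<in> Y" "Suc m \<le> i"
    then have "v i = 0" "w i = 0" using Y(2) by (auto simp: pvecs_def)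
    then show "v i / \<psi> v = w i / \<psi> w" by simp
  next
    fix v w assume "v \<in> Y" "w \<in> Y" "\<And>i. v i / \<psi> v = w i / \<psi> w"
    then show "v = w" by (rule inj)
  qed (use Y(1,3) in auto)
qed

subsection \<open>The projective bound\<close>

text \<open>Projective points are handled through one vector each, so that forms have values on
  them.\<close>

definition projset :: "(nat \<Rightarrow> 'a::field) set \<Rightarrow> bool" where
  "projset X \<longleftrightarrow> (\<forall>v\<in>X. v \<noteq> (\<lambda>_. 0)) \<and> (\<forall>v\<in>X. \<forall>w\<in>X. \<forall>c. w = (\<lambda>i. c * v i) \<longrightarrow> w = v)"

lemma projset_subset: "projset X \<Longrightarrow> Y \<subseteq> X \<Longrightarrow> projset Y"
  unfolding projset_def by blast

lemma CARD_field_ge_2: "2 \<le> CARD('a::{finite,field})"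
  using card_mono[of "UNIV :: 'a set" "{0, 1}"] by simp

section \<open>Averaging over hyperplanes\<close>

lemma proj_card_geometric: "b * proj_card b k + 1 = proj_card b k + b ^ k"
  by (induction k) (auto simp: proj_card_def algebra_simps)

lemma proj_card_Suc: "proj_card b (Suc k) = proj_card b k + b ^ k"
  by (simp add: proj_card_def)

text \<open>\<open>avg\<close> holds for a best hyperplane of an \<open>n + 1\<close>-dimensional
  space, containing \<open>N\<close> of the \<open>x\<close> points, and \<open>xn\<close> says that
  the points fit into that space. After multiplication by \<open>q - 1\<close> only integer
  inequalities in \<open>A = q ^ k\<close> and \<open>B = q ^ n\<close> remain.\<close>

lemma average_hyperplane_bounds:
  fixes q x n k v N :: nat
  assumes q: "2 \<le> q" and x: "x = proj_card q (Suc k) + v" and v: "1 \<le> v" "v \<le> q ^ Suc k"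
    and xn: "x * (q - 1) \<le> q ^ Suc n - 1"
    and avg: "x * (q ^ n - 1) \<le> N * (q ^ Suc n - 1)"
  shows "proj_card q k < N" and "x \<le> N + q ^ Suc k"
proof -
  define A where "A = int q ^ k"
  define B where "B = int q ^ n"
  define Q where "Q = int q"
  define X where "X = int x"
  have A1: "1 \<le> A" and B1: "1 \<le> B" and Q2: "2 \<le> Q"
    using q by (auto simp: A_def B_def Q_def)
  have dp1: "(Q - 1) * int (proj_card q k) = A - 1"
    using arg_cong[OF proj_card_geometric[of q k], of int] by (simp add: A_def Q_def algebra_simps)
  have dp2: "(Q - 1) * int (proj_card q (Suc k)) = Q * A - 1"
    using arg_cong[OF proj_card_geometric[of q "Suc k"], of int] by (simp add: A_def Q_def algebra_simps)
  have qn: "int (q ^ n - 1) = B - 1" "int (q ^ Suc n - 1) = Q * B - 1" "int (q - 1) = Q - 1"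
    using q by (auto simp: B_def Q_def of_nat_diff)
  have X1: "(Q - 1) * X = Q * A - 1 + (Q - 1) * int v"
    using dp2 by (simp add: X_def x algebra_simps)
  have xn': "(Q - 1) * X \<le> Q * B - 1"
    using xn qn by (metis X_def mult.commute of_nat_le_iff of_nat_mult)
  have avg': "X * (B - 1) \<le> int N * (Q * B - 1)"
    using avg qn by (metis X_def of_nat_le_iff of_nat_mult)
  have v1: "Q - 1 \<le> (Q - 1) * int v" using v Q2 by simp
  have v2: "(Q - 1) * int v \<le> (Q - 1) * (Q * A)"
  proof (rule mult_left_mono)
    have "int v \<le> int (q ^ Suc k)" using v(2) by (rule of_nat_mono)
    then show "int v \<le> Q * A" by (simp add: Q_def A_def)
  qed (use Q2 in simp)
  \<comment> \<open>More than \<open>proj_card q (Suc k)\<close> points fit into the space, hence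
    \<open>k < n\<close> and \<open>q ^ Suc k \<le> q ^ n\<close>; both contradictions rest on
    this.\<close>
  have "Q * A < Q * B" using X1 xn' v1 Q2 by linarith
  then have "int q ^ k < int q ^ n" using Q2 by (simp add: A_def B_def)
  then have "k < n" using q by (simp add: power_strict_increasing_iff)
  then have "q ^ Suc k \<le> q ^ n" using q by (intro power_increasing) auto
  then have BA: "Q * A \<le> B" by (simp add: A_def B_def Q_def flip: of_nat_power of_nat_mult)
  have QB: "0 < Q * B - 1" using Q2 B1 by (smt (verit) mult_le_cancel_left1)
  show "proj_card q k < N"
  proof (rule ccontr)
    assume "\<not> ?thesis"
    then have "int N \<le> int (proj_card q k)" by simp
    then have "(Q - 1) * int N \<le> (Q - 1) * int (proj_card q k)" using Q2 by (intro mult_left_mono) auto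
    then have "(Q - 1) * int N \<le> A - 1" using dp1 by simp
    then have "(Q - 1) * int N * (Q * B - 1) \<le> (A - 1) * (Q * B - 1)"
      using QB by (intro mult_right_mono) auto
    moreover have "(Q - 1) * (X * (B - 1)) \<le> (Q - 1) * (int N * (Q * B - 1))"
      using avg' Q2 by (intro mult_left_mono) auto
    moreover have "(Q * A - 1 + (Q - 1)) * (B - 1) \<le> (Q - 1) * X * (B - 1)"
      using X1 v1 B1 by (intro mult_right_mono) auto
    ultimately have "(Q * A - 1 + (Q - 1)) * (B - 1) \<le> (A - 1) * (Q * B - 1)"
      by (simp add: mult.assoc)
    then have "Q * B + (Q - 2) * (B - 1) \<le> Q * A - A + 1" by (simp add: algebra_simps)
    moreover have "0 \<le> (Q - 2) * (B - 1)" using Q2 B1 by simp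
    moreover have "2 * B \<le> Q * B" using Q2 B1 by (intro mult_right_mono) auto
    ultimately show False using BA A1 B1 by linarith
  qed
  show "x \<le> N + q ^ Suc k"
  proof (rule ccontr)
    assume "\<not> ?thesis"
    then have "N + q ^ Suc k + 1 \<le> x" by simp
    then have "int (N + q ^ Suc k + 1) \<le> int x" by (rule of_nat_mono)
    then have "Q * A + 1 \<le> X - int N" by (simp add: X_def Q_def A_def)
    then have "(Q * A + 1) * (Q * B - 1) \<le> (X - int N) * (Q * B - 1)"
      using QB by (intro mult_right_mono) auto
    also have "\<dots> \<le> X * (Q * B - 1) - X * (B - 1)" using avg' by (simp add: algebra_simps)
    also have "\<dots> = (Q - 1) * X * B" by (simp add: algebra_simps)
    also have "\<dots> \<le> (Q * (Q * A) - 1) * B"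
      using X1 v2 B1 by (intro mult_right_mono) (auto simp: algebra_simps)
    finally have "Q * B + B \<le> Q * A + 1" by (simp add: algebra_simps)
    moreover have "2 * B \<le> Q * B" using Q2 B1 by (intro mult_right_mono) auto
    ultimately show False using BA B1 by linarith
  qed
qed

text \<open>The nonzero multiples of the elements of \<open>X\<close> are pairwise distinct, nonzero
  and contained in \<open>U\<close>.\<close>

lemma card_projset_bound:
  fixes X :: "(nat \<Rightarrow> 'a::{finite,field}) set"
  assumes U: "lin_closed U" "finite U" and X: "X \<subseteq> U" "projset X"
  shows "card X * (CARD('a) - 1) \<le> card U - 1"
proof -
  have "card (X \<times> (UNIV - {0 :: 'a})) \<le> card (U - {\<lambda>_. 0})"
  proof (rule card_inj_on_le[where f = "\<lambda>(v, c) i. c * v i"])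
    show "inj_on (\<lambda>(v, c) i. c * v i) (X \<times> (UNIV - {0}))"
    proof (rule inj_onI)
      fix p p' :: "(nat \<Rightarrow> 'a) \<times> 'a"
      assume p: "p \<in> X \<times> (UNIV - {0})" "p' \<in> X \<times> (UNIV - {0})"
        "(case p of (v, c) \<Rightarrow> \<lambda>i. c * v i) = (case p' of (v, c) \<Rightarrow> \<lambda>i. c * v i)"
      obtain v c w c' where pc: "p = (v, c)" "p' = (w, c')" by (metis surj_pair)
      then have *: "v \<in> X" "w \<in> X" "c \<noteq> 0" "c' \<noteq> 0" "(\<lambda>i. c * v i) = (\<lambda>i. c' * w i)"
        using p by auto
      have "w i = c / c' * v i" for i
        using fun_cong[OF *(5), of i] *(4) by (simp add: field_simps)
      then have "w = (\<lambda>i. c / c' * v i)" by blast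
      then have wv: "w = v" using X * unfolding projset_def by blast
      moreover obtain i where "v i \<noteq> 0" using X * unfolding projset_def by blast
      ultimately show "p = p'" using fun_cong[OF *(5), of i] pc by simp
    qed
    show "(\<lambda>(v, c) i. c * v i) ` (X \<times> (UNIV - {0})) \<subseteq> U - {\<lambda>_. 0}"
    proof (rule image_subsetI)
      fix p :: "(nat \<Rightarrow> 'a) \<times> 'a" assume p: "p \<in> X \<times> (UNIV - {0})"
      obtain v c where pc: "p = (v, c)" by force
      have *: "v \<in> X" "c \<noteq> 0" using p pc by auto
      then obtain i where "v i \<noteq> 0" using X unfolding projset_def by blast
      then have "c * v i \<noteq> 0" using * by simp
      then have "(\<lambda>i. c * v i) \<noteq> (\<lambda>_. 0)" by (auto dest: fun_cong)
      moreover have "(\<lambda>i. c * v i) \<in> U" using lin_closed_scale[OF U(1), of v c] X * by blast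
      ultimately show "(case p of (v, c) \<Rightarrow> \<lambda>i. c * v i) \<in> U - {\<lambda>_. 0}" using pc by simp
    qed
  qed (use U in auto)
  then show ?thesis
    using lin_closed_zero[OF U(1)] U(2) by (simp add: card_cartesian_product card_Diff_singleton)
qed

lemma exists_nonzero_coordinate:
  assumes "v \<in> pvecs m" "v \<noteq> (\<lambda>_. 0)"
  obtains k where "k \<le> m" "v k \<noteq> 0"
proof -
  obtain k where "v k \<noteq> 0" using assms(2) by auto
  moreover have "k \<le> m" using \<open>v k \<noteq> 0\<close> assms(1) by (intro leI) (auto simp: pvecs_def)
  ultimately show ?thesis using that by blast
qed

text \<open>Double counting: each point of \<open>X\<close> is a zero of \<open>q ^ n - 1\<close> of
  the \<open>q ^ Suc n - 1\<close> nonzero functionals that linear forms induce on \<open>U\<close>,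
  so some functional has at least the average number of zeros.\<close>

lemma exists_rich_hyperplane:
  fixes X :: "(nat \<Rightarrow> 'a::{finite,field}) set"
  assumes U: "finite U" "U \<subseteq> pvecs m" and X: "X \<subseteq> U" "projset X"
    and L: "card (restr U ` lins m) = CARD('a) ^ Suc n"
  obtains \<psi> where "\<psi> \<in> lins m" "\<exists>u\<in>U. \<psi> u \<noteq> 0"
    "card X * (CARD('a) ^ n - 1) \<le> card {v \<in> X. \<psi> v = 0} * (CARD('a) ^ Suc n - 1)"
proof -
  let ?q = "CARD('a)"
  define L' where "L' = restr U ` lins m - {\<lambda>_. 0}"
  have finX: "finite X" using U X finite_subset by blast
  have LC: "lin_closed (restr U ` lins m)" by (rule lin_closed_restr[OF lin_closed_lins])
  have finL: "finite (restr U ` lins m)" by (rule finite_restr_image[OF U(1)])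
  have z: "(\<lambda>_. 0) \<in> restr U ` lins m" by (rule lin_closed_zero[OF LC])
  have cL': "card L' = ?q ^ Suc n - 1" unfolding L'_def using z L finL by (simp add: card_Diff_singleton)
  have pt: "card {f \<in> L'. f v = 0} = ?q ^ n - 1" if vX: "v \<in> X" for v
  proof -
    obtain k where k: "k \<le> m" "v k \<noteq> 0"
    proof (rule exists_nonzero_coordinate)
      show "v \<in> pvecs m" "v \<noteq> (\<lambda>_. 0)" using vX U X unfolding projset_def by blast+
    qed
    have "card (restr U ` lins m) = ?q * card {f \<in> restr U ` lins m. f v = 0}"
    proof (rule card_kernel_functional[where \<phi> = "\<lambda>f. f v", OF LC])
      show "restr U (\<lambda>v. v k) \<in> restr U ` lins m" using coordinate_in_lins[OF k(1)] by (rule imageI)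
      show "restr U (\<lambda>v. v k) v \<noteq> 0" using k vX X by (auto simp: restr_def)
    qed simp
    then have "card {f \<in> restr U ` lins m. f v = 0} = ?q ^ n" using L by simp
    moreover have "{f \<in> L'. f v = 0} = {f \<in> restr U ` lins m. f v = 0} - {\<lambda>_. 0}"
      by (auto simp: L'_def)
    ultimately show ?thesis using z finL by (simp add: card_Diff_singleton)
  qed
  have "(\<Sum>f\<in>L'. card {v \<in> X. f v = 0}) = (\<Sum>v\<in>X. card {f \<in> L'. f v = 0})"
    using sum.swap_restrict[of L' X "\<lambda>_ _. 1 :: nat" "\<lambda>f v. f v = 0"] finX finL by (simp add: L'_def)
  also have "\<dots> = card X * (?q ^ n - 1)" using pt by simp
  finally have tot: "(\<Sum>f\<in>L'. card {v \<in> X. f v = 0}) = card X * (?q ^ n - 1)" .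
  have "\<exists>f\<in>L'. card X * (?q ^ n - 1) \<le> card {v \<in> X. f v = 0} * card L'"
  proof (rule ccontr)
    assume "\<not> ?thesis"
    then have lt: "card {v \<in> X. f v = 0} * card L' < card X * (?q ^ n - 1)" if "f \<in> L'" for f
      using that by force
    have "1 < ?q ^ Suc n" using CARD_field_ge_2[where 'a = 'a] by (intro one_less_power) auto
    then have "0 < card L'" using cL' by simp
    then have "L' \<noteq> {}" "finite L'" by (simp_all add: card_gt_0_iff)
    then have "(\<Sum>f\<in>L'. card {v \<in> X. f v = 0} * card L') < (\<Sum>f\<in>L'. card X * (?q ^ n - 1))"
      using lt by (intro sum_strict_mono) auto
    then show False using tot by (simp flip: sum_distrib_right)
  qed
  then obtain f where f: "f \<in> L'" "card X * (?q ^ n - 1) \<le> card {v \<in> X. f v = 0} * (?q ^ Suc n - 1)"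
    using cL' by auto
  then obtain \<psi> where psi: "\<psi> \<in> lins m" "f = restr U \<psi>" by (auto simp: L'_def)
  have "{v \<in> X. f v = 0} = {v \<in> X. \<psi> v = 0}" using X psi by (auto simp: restr_def)
  moreover have "\<exists>u\<in>U. \<psi> u \<noteq> 0" 
  proof (rule ccontr)
    assume "\<not> ?thesis"
    then have "f = (\<lambda>_. 0)" unfolding psi(2) by (auto simp: restr_def)
    then show False using f(1) by (simp add: L'_def)
  qed
  ultimately show ?thesis using that[OF psi(1)] f(2) by simp
qed

text \<open>The space and its dual shrink together. Every vector of \<open>U\<close> differs from
  one of \<open>H\<close> by a multiple of \<open>u\<close>, so functionals on \<open>H\<close>
  correspond to those on \<open>U\<close> that vanish at \<open>u\<close>.\<close>

lemma hyperplane_section: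
  fixes U :: "(nat \<Rightarrow> 'a::{finite,field}) set"
  assumes U: "lin_closed U" and psi: "\<psi> \<in> lins m" and u: "u \<in> U" "\<psi> u \<noteq> 0"
  defines "H \<equiv> {v \<in> U. \<psi> v = 0}"
  shows "lin_closed H" and "card U = CARD('a) * card H"
    and "card (restr U ` lins m) = CARD('a) * card (restr H ` lins m)"
proof -
  have lin: "\<psi> (\<lambda>i. v i + c * w i) = \<psi> v + c * \<psi> w" for v w c by (rule lins_linear[OF psi])
  have psi0: "\<psi> (\<lambda>_. 0) = 0" using lin[of u "-1" u] by simp
  show "lin_closed H"
    unfolding lin_closed_def H_def
    using lin_closed_zero[OF U] lin_closedD[OF U] lin psi0 by auto
  show "card U = CARD('a) * card H"
    unfolding H_def by (rule card_kernel_functional[where \<phi> = \<psi>, OF U lin u])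
  let ?L = "restr U ` lins m"
  have LC: "lin_closed ?L"
    by (rule lin_closed_restr[OF lin_closed_lins])
  let ?K = "{f \<in> ?L. f u = 0}"
  have "card ?L = CARD('a) * card ?K"
  proof (rule card_kernel_functional[where \<phi> = "\<lambda>f. f u", OF LC])
    show "restr U \<psi> \<in> ?L" using psi by (rule imageI)
    show "restr U \<psi> u \<noteq> 0" using u by (simp add: restr_def)
  qed simp
  moreover have "bij_betw (restr H) ?K (restr H ` lins m)"
  proof (rule bij_betw_imageI)
    have dec: "f v = f (\<lambda>i. v i + (- (\<psi> v / \<psi> u)) * u i)" if "f \<in> ?K" "v \<in> U" for f v
    proof -
      obtain g where g: "g \<in> lins m" "f = restr U g" using \<open>f \<in> ?K\<close> by auto
      have "(\<lambda>i. v i + (- (\<psi> v / \<psi> u)) * u i) \<in> U" by (rule lin_closedD[OF U that(2) u(1)])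
      then have "f (\<lambda>i. v i + (- (\<psi> v / \<psi> u)) * u i) = g v + (- (\<psi> v / \<psi> u)) * g u"
        unfolding g(2) restr_def using lins_linear[OF g(1), of v "- (\<psi> v / \<psi> u)" u] by simp
      moreover have "g u = 0" "f v = g v" using that u g by (auto simp: restr_def)
      ultimately show ?thesis by simp
    qed
    have inH: "(\<lambda>i. v i + (- (\<psi> v / \<psi> u)) * u i) \<in> H" if "v \<in> U" for v
    proof -
      have "\<psi> (\<lambda>i. v i + (- (\<psi> v / \<psi> u)) * u i) = 0" unfolding lin using u(2) by simp
      then show ?thesis unfolding H_def using lin_closedD[OF U that u(1)] by blast
    qed
    show "inj_on (restr H) ?K"
    proof (rule inj_onI)
      fix f g assume fg: "f \<in> ?K" "g \<in> ?K" "restr H f = restr H g"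
      show "f = g"
      proof
        fix v
        show "f v = g v"
        proof (cases "v \<in> U")
          case True
          then show ?thesis
            using dec[OF fg(1) True] dec[OF fg(2) True] restr_eqD[OF fg(3) inH[OF True]] by simp
        next
          case False
          then show ?thesis using fg by (auto simp: restr_def)
        qed
      qed
    qed
    show "restr H ` ?K = restr H ` lins m"
    proof
      have "restr H (restr U f) = restr H f" for f :: "(nat \<Rightarrow> 'a) \<Rightarrow> 'a"
        by (auto simp: restr_def H_def)
      then show "restr H ` ?K \<subseteq> restr H ` lins m" by auto
      show "restr H ` lins m \<subseteq> restr H ` ?K"
      proof (rule image_subsetI)
        fix f :: "(nat \<Rightarrow> 'a) \<Rightarrow> 'a" assume f: "f \<in> lins m"
        \<comment> \<open>The multiple of \<open>\<psi>\<close> makes the functional vanish at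
          \<open>u\<close> and leaves its values on \<open>H\<close> unchanged.\<close>
        define g where "g = (\<lambda>v. f v + (- (f u / \<psi> u)) * \<psi> v)"
        have "g \<in> lins m" unfolding g_def by (rule lin_closedD[OF lin_closed_lins f psi])
        moreover have "restr U g u = 0" using u by (simp add: restr_def g_def)
        moreover have "restr H f = restr H (restr U g)"
          by (rule restr_eqI) (auto simp: H_def restr_def g_def)
        ultimately show "restr H f \<in> restr H ` ?K" by auto
      qed
    qed
  qed
  ultimately show "card ?L = CARD('a) * card (restr H ` lins m)"
    using bij_betw_same_card[of "restr H" ?K "restr H ` lins m"] by (simp only:)
qed

text \<open>The cardinality hypotheses say that \<open>U\<close> has dimension \<open>N\<close> and
  that restricted linear forms make up its whole dual; hyperplane sections preserve this while the
  forms keep all their variables. The range of \<open>v\<close> makes \<open>k\<close> unique for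
  each nonempty \<open>X\<close>.\<close>

lemma card_restr_forms_projective:
  fixes X :: "(nat \<Rightarrow> 'a::{finite,field}) set"
  assumes e: "e + 1 < CARD('a)"
    and "lin_closed U" "finite U" "U \<subseteq> pvecs m" "card U = CARD('a) ^ N" "card (restr U ` lins m) = CARD('a) ^ N"
    and "X \<subseteq> U" "projset X" "card X = proj_card CARD('a) k + v" "1 \<le> v" "v \<le> CARD('a) ^ k"
  shows "CARD('a) ^ cond_bound CARD('a) e k v \<le> card (restr_forms m (Suc e) X)"
  using assms(2-)
proof (induction N arbitrary: U X k v)
  case 0
  then have "card U = 1" by simp
  then have "U = {\<lambda>_. 0}"
    using lin_closed_zero[OF 0(1)] by (metis card_1_singletonE singletonD)
  then have "X = {}" using 0(6,7) by (auto simp: projset_def)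
  then show ?case using 0(8,9) by simp
next
  case (Suc n)
  let ?q = "CARD('a)"
  note q2 = CARD_field_ge_2[where 'a = 'a]
  have finX: "finite X" using Suc.prems(2,6) finite_subset by blast
  have affine: "?q ^ low_count ?q 0 e' (card Y) \<le> card (restr_forms m e' Y)"
    if psi: "\<psi> \<in> lins m" and Y: "Y \<subseteq> X" "\<And>v. v \<in> Y \<Longrightarrow> \<psi> v \<noteq> 0" for \<psi> Y e'
  proof (rule card_restr_forms_affine[OF psi])
    show "finite Y" "Y \<subseteq> pvecs m" using Y finX Suc.prems(3,6) finite_subset by blast+
    fix v w assume vw: "v \<in> Y" "w \<in> Y" "\<And>i. v i / \<psi> v = w i / \<psi> w"
    have "v i = \<psi> v / \<psi> w * w i" for i
      using vw(3)[of i] Y(2)[OF vw(1)] Y(2)[OF vw(2)] by (simp add: field_simps)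
    then have "v = (\<lambda>i. \<psi> v / \<psi> w * w i)" by blast
    then show "v = w" using Suc.prems(7) vw(1,2) Y(1) unfolding projset_def by blast
  qed (use Y in auto)
  show ?case
  proof (cases k)
    case 0
    then have v1: "v = 1" using Suc.prems by simp
    then have "card X = 1" using Suc.prems(8) 0 by (simp add: proj_card_def)
    then obtain x where x: "X = {x}" by (rule card_1_singletonE)
    obtain j where j: "j \<le> m" "x j \<noteq> 0"
    proof (rule exists_nonzero_coordinate)
      show "x \<in> pvecs m" "x \<noteq> (\<lambda>_. 0)" using x Suc.prems(3,6,7) unfolding projset_def by blast+
    qed
    have "cond_bound ?q e k v = 1" using 0 v1 by (simp add: cond_bound_def)
    then show ?thesis
      using card_restr_forms_point[OF coordinate_in_lins[OF j(1)], of x "Suc e"] j x by simp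
  next
    case (Suc k')
    obtain \<psi> where psi: "\<psi> \<in> lins m" "\<exists>u\<in>U. \<psi> u \<noteq> 0"
      "card X * (?q ^ n - 1) \<le> card {v \<in> X. \<psi> v = 0} * (?q ^ Suc n - 1)"
      using exists_rich_hyperplane[OF Suc.prems(2,3,6,7,5)] .
    obtain u where u: "u \<in> U" "\<psi> u \<noteq> 0" using psi(2) by blast
    define H where "H = {v \<in> U. \<psi> v = 0}"
    note hs = hyperplane_section[OF Suc.prems(1) psi(1) u, folded H_def]
    let ?A = "{v \<in> X. \<psi> v = 0}" and ?B = "{v \<in> X. \<psi> v \<noteq> 0}"
    have q0: "?q > 0" by simp
    have cH: "card H = ?q ^ n" using hs(2) Suc.prems(4) q0 by simp
    have cLH: "card (restr H ` lins m) = ?q ^ n" using hs(3) Suc.prems(5) q0 by simp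
    have IH: "?q ^ cond_bound ?q e k v \<le> card (restr_forms m (Suc e) ?A)"
      if "card ?A = proj_card ?q k + v" "1 \<le> v" "v \<le> ?q ^ k" for k v
      by (rule Suc.IH[OF hs(1) _ _ cH cLH _ _ that])
        (use Suc.prems(2,3,6) projset_subset[OF Suc.prems(7)] in \<open>auto simp: H_def\<close>)
    have AB: "card X = card ?A + card ?B"
      using finX by (subst card_Un_disjoint[symmetric]) (auto intro!: arg_cong[where f = card])
    have "card X * (?q - 1) \<le> ?q ^ Suc n - 1"
      using card_projset_bound[OF Suc.prems(1,2,6,7)] Suc.prems(4) by simp
    note bounds = average_hyperplane_bounds[OF q2 Suc.prems(8)[unfolded Suc] Suc.prems(9)
      Suc.prems(10)[unfolded Suc] this psi(3)]
    have lowA: "proj_card ?q k' < card ?A" and lowB: "card ?B \<le> ?q ^ Suc k'" using bounds AB by auto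
    have step: "?q ^ cond_bound ?q e k v \<le> card (restr_forms m (Suc e) X)"
      if "cond_bound ?q e k v \<le> a + low_count ?q 0 e (card ?B)" "?q ^ a \<le> card (restr_forms m (Suc e) ?A)" for a
    proof -
      have "?q ^ cond_bound ?q e k v \<le> ?q ^ (a + low_count ?q 0 e (card ?B))"
        using that(1) by (intro power_increasing) auto
      also have "\<dots> = ?q ^ a * ?q ^ low_count ?q 0 e (card ?B)" by (rule power_add)
      also have "\<dots> \<le> card (restr_forms m (Suc e) ?A) * card (restr_forms m e ?B)"
        by (intro mult_le_mono that(2) affine[OF psi(1)]) auto
      also have "\<dots> \<le> card (restr_forms m (Suc e) X)" by (rule card_restr_forms_hyperplane[OF finX psi(1)])
      finally show ?thesis .
    qed
    \<comment> \<open>The section has more than \<open>proj_card q k'\<close> points. Up to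
      \<open>proj_card q (Suc k')\<close> its index drops to \<open>k'\<close>, beyond that it stays
      \<open>k\<close>; the two numerical steps for \<open>cond_bound\<close> match these
      cases.\<close>
    show ?thesis
    proof (cases "card ?A \<le> proj_card ?q (Suc k')")
      case True
      define v' where "v' = card ?A - proj_card ?q k'"
      have v': "card ?A = proj_card ?q k' + v'" "1 \<le> v'" "v' \<le> ?q ^ k'"
        using True lowA by (auto simp: v'_def proj_card_Suc)
      show ?thesis
      proof (rule step[OF _ IH[OF v']])
        show "cond_bound ?q e k v \<le> cond_bound ?q e k' v' + low_count ?q 0 e (card ?B)"
          unfolding Suc
        proof (rule cond_bound_step_low[OF q2 e v'(2,3) Suc.prems(9) Suc.prems(10)[unfolded Suc] _ lowB])
          show "v' + card ?B = ?q ^ k' + v"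
            using AB v'(1) Suc.prems(8)[unfolded Suc] by (simp add: proj_card_Suc)
        qed
      qed
    next
      case False
      define v' where "v' = card ?A - proj_card ?q (Suc k')"
      have v': "card ?A = proj_card ?q k + v'" "1 \<le> v'" using False by (auto simp: v'_def Suc)
      have vv: "v' + card ?B = v" using AB v'(1) Suc.prems(8) by simp
      then have "v' \<le> ?q ^ k" using Suc.prems(10) by simp
      from step[OF cond_bound_step_high[OF q2 e vv Suc.prems(10)] IH[OF v' this]] show ?thesis .
    qed
  qed
qed

subsection \<open>Counting monomials, points and independent families\<close>

text \<open>The number of monomials of degree \<open>Suc e\<close> in \<open>k\<close> variables,
  split by the last variable that occurs; \<open>k = 0\<close> is included.\<close>

definition binom_sum :: "nat \<Rightarrow> nat \<Rightarrow> nat" where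
  "binom_sum e k = (\<Sum>j<k. (j + e) choose e)"

lemma binom_sum_eq_choose: "binom_sum e (Suc k) = (k + Suc e) choose Suc e"
proof -
  have "binom_sum e (Suc k) = (\<Sum>j\<le>k. (e + j) choose e)"
    unfolding binom_sum_def lessThan_Suc_atMost by (simp add: add.commute)
  also have "\<dots> = (e + k + 1) choose (e + 1)" by (rule choose_rising_sum(1))
  finally show ?thesis by (simp add: ac_simps)
qed

text \<open>With \<open>j = m + 1 - a\<close> the sum over \<open>a\<close> consists of the top
  \<open>i\<close> terms of \<open>binom_sum e (Suc m)\<close>: the monomials that involve one of
  the last \<open>i\<close> variables.\<close>

lemma binom_sum_split:
  assumes "i \<le> Suc m"
  shows "(\<Sum>a=1..i. (m + Suc e - a) choose e) + binom_sum e (Suc m - i) = binom_sum e (Suc m)"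
  using assms
proof (induction i)
  case 0
  then show ?case by simp
next
  case (Suc i)
  then have eq: "Suc m - i = Suc (m - i)" by simp
  have "(m + Suc e - Suc i) = m - i + e" using Suc.prems by simp
  then show ?case using Suc unfolding eq by (simp add: binom_sum_def)
qed

lemma card_mon_exps: "card (mon_exps m d) = (m + d) choose d"
proof (induction m arbitrary: d)
  case 0
  have "mon_exps 0 d = {\<lambda>i. if i = 0 then d else 0}"
    by (auto simp: mon_exps_def fun_eq_iff)
  then show ?case by simp
next
  case (Suc m)
  have "mon_exps (Suc m) d = (\<Union>y\<le>d. (\<lambda>\<alpha>. \<alpha>(Suc m := y)) ` mon_exps m (d - y))" (is "_ = ?R")
  proof
    show "mon_exps (Suc m) d \<subseteq> ?R"
    proof
      fix \<beta> assume \<beta>: "\<beta> \<in> mon_exps (Suc m) d"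
      have "(\<Sum>i\<le>m. (\<beta>(Suc m := 0)) i) = (\<Sum>i\<le>m. \<beta> i)" by (rule sum.cong) auto
      then have "\<beta>(Suc m := 0) \<in> mon_exps m (d - \<beta> (Suc m))" "\<beta> (Suc m) \<le> d"
        using \<beta> by (auto simp: mon_exps_def)
      moreover have "\<beta> = (\<beta>(Suc m := 0))(Suc m := \<beta> (Suc m))" by simp
      ultimately show "\<beta> \<in> ?R" by blast
    qed
    show "?R \<subseteq> mon_exps (Suc m) d"
    proof clarify
      fix y \<alpha> assume *: "y \<le> d" "\<alpha> \<in> mon_exps m (d - y)"
      have "(\<Sum>i\<le>m. (\<alpha>(Suc m := y)) i) = (\<Sum>i\<le>m. \<alpha> i)" by (rule sum.cong) auto
      then show "\<alpha>(Suc m := y) \<in> mon_exps (Suc m) d" using * by (auto simp: mon_exps_def)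
    qed
  qed
  then have "card (mon_exps (Suc m) d) = card ?R" by simp
  also have "\<dots> = (\<Sum>y\<le>d. card ((\<lambda>\<alpha>. \<alpha>(Suc m := y)) ` mon_exps m (d - y)))"
  proof (rule card_UN_disjoint)
    show "\<forall>y\<in>{..d}. \<forall>z\<in>{..d}. y \<noteq> z \<longrightarrow>
      (\<lambda>\<alpha>. \<alpha>(Suc m := y)) ` mon_exps m (d - y) \<inter> (\<lambda>\<alpha>. \<alpha>(Suc m := z)) ` mon_exps m (d - z) = {}"
      by (auto dest: fun_upd_eqD)
  qed (auto simp: finite_mon_exps)
  also have "\<dots> = (\<Sum>y\<le>d. (m + (d - y)) choose (d - y))"
  proof (rule sum.cong[OF refl])
    fix y
    have "inj_on (\<lambda>\<alpha>. \<alpha>(Suc m := y)) (mon_exps m (d - y))"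
    proof (rule inj_onI)
      fix \<alpha> \<beta> assume *: "\<alpha> \<in> mon_exps m (d - y)" "\<beta> \<in> mon_exps m (d - y)" "\<alpha>(Suc m := y) = \<beta>(Suc m := y)"
      show "\<alpha> = \<beta>"
      proof
        fix i
        show "\<alpha> i = \<beta> i" using fun_cong[OF *(3), of i] *(1,2) by (cases "i = Suc m") (auto simp: mon_exps_def)
      qed
    qed
    then show "card ((\<lambda>\<alpha>. \<alpha>(Suc m := y)) ` mon_exps m (d - y)) = (m + (d - y)) choose (d - y)"
      by (simp add: card_image Suc.IH)
  qed
  also have "\<dots> = (\<Sum>y\<le>d. (m + y) choose y)"
    using sum.nat_diff_reindex[of "\<lambda>y. (m + y) choose y" "Suc d"] by (simp add: lessThan_Suc_atMost)
  also have "\<dots> = (Suc m + d) choose d" by (simp add: sum_choose_lower)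
  finally show ?case .
qed

lemma cond_bound_small:
  assumes "2 \<le> b" "e < b" "v \<le> Suc e"
  shows "cond_bound b e k v = binom_sum e k + v"
  using assms by (simp add: cond_bound_def binom_sum_def low_count_power)

text \<open>For the maximal excess the bound is the number of all monomials, since the first
  \<open>Suc e\<close> numbers all count and balance \<open>min\<close>. It serves to prove that
  evaluation is injective.\<close>

lemma cond_bound_full:
  assumes "2 \<le> b" "e < b" "Suc e \<le> b ^ k"
  shows "cond_bound b e k (b ^ k) = binom_sum e (Suc k)"
proof -
  have "low_count b 0 e (Suc e) \<le> low_count b 0 e (b ^ k)" using assms(3) by (rule low_count_mono)
  then show ?thesis
    using assms low_count_initial[OF assms(1) _ assms(2), of "Suc e"] by (simp add: cond_bound_def binom_sum_def low_count_power)
qed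

section \<open>The coordinate space and its dual\<close>

lemma pvecs_alt: "pvecs m = {f. \<forall>x. x \<notin> {..m} \<longrightarrow> f x = 0}"
  by (auto simp: pvecs_def)

lemma finite_pvecs: "finite (pvecs m :: (nat \<Rightarrow> 'a::{finite,field}) set)"
  unfolding pvecs_alt by (rule finite_functions_zero_outside) simp

lemma card_pvecs: "card (pvecs m :: (nat \<Rightarrow> 'a::{finite,field}) set) = CARD('a) ^ Suc m"
  unfolding pvecs_alt by (subst card_functions_zero_outside) auto

lemma lin_closed_pvecs: "lin_closed (pvecs m)"
  by (auto simp: lin_closed_def pvecs_def)

text \<open>Unit vectors recover the coefficients. With \<open>card_pvecs\<close> this makes
  \<open>card_restr_forms_projective\<close> applicable to the full space.\<close>

lemma card_lins_pvecs:
  "card (restr (pvecs m) ` (lins m :: ((nat \<Rightarrow> 'a::{finite,field}) \<Rightarrow> 'a) set)) = CARD('a) ^ Suc m"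
proof -
  have "bij_betw (\<lambda>a. restr (pvecs m) (linform m a)) (pvecs m) (restr (pvecs m) ` (lins m :: ((nat \<Rightarrow> 'a) \<Rightarrow> 'a) set))"
  proof (rule bij_betw_imageI)
    show "inj_on (\<lambda>a. restr (pvecs m) (linform m a)) (pvecs m :: (nat \<Rightarrow> 'a) set)"
    proof (rule inj_onI)
      fix a b :: "nat \<Rightarrow> 'a"
      assume ab: "a \<in> pvecs m" "b \<in> pvecs m" "restr (pvecs m) (linform m a) = restr (pvecs m) (linform m b)"
      show "a = b"
      proof
        fix k
        show "a k = b k"
        proof (cases "k \<le> m")
          case True
          have "linform m c (\<lambda>i. if i = k then 1 else 0) = c k" for c :: "nat \<Rightarrow> 'a"
            using True by (simp add: linform_def if_distrib[of "\<lambda>x. _ * x"] cong: if_cong)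
          moreover have "(\<lambda>i. if i = k then 1 else 0) \<in> (pvecs m :: (nat \<Rightarrow> 'a) set)"
            using True by (auto simp: pvecs_def)
          ultimately show ?thesis using restr_eqD[OF ab(3)] by metis
        next
          case False
          then show ?thesis using ab by (auto simp: pvecs_def)
        qed
      qed
    qed
    show "(\<lambda>a. restr (pvecs m) (linform m a)) ` pvecs m = restr (pvecs m) ` (lins m :: ((nat \<Rightarrow> 'a) \<Rightarrow> 'a) set)"
    proof -
      have "linform m a \<in> linform m ` pvecs m" for a :: "nat \<Rightarrow> 'a"
      proof (rule image_eqI)
        show "linform m a = linform m (\<lambda>i. if i \<le> m then a i else 0)" by (auto simp: linform_def)
        show "(\<lambda>i. if i \<le> m then a i else 0) \<in> pvecs m" by (auto simp: pvecs_def)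
      qed
      then have "lins m = linform m ` (pvecs m :: (nat \<Rightarrow> 'a) set)" by (auto simp: lins_def)
      then show ?thesis by (simp add: image_image)
    qed
  qed
  from bij_betw_same_card[OF this] show ?thesis by (simp add: card_pvecs)
qed

section \<open>Projective points and their representatives\<close>

lemma Proj_elem:
  assumes "P \<in> Proj m" "v \<in> P"
  shows "v \<in> pvecs m" and "v \<noteq> (\<lambda>_. 0)" and "P = {(\<lambda>i. c * v i) | c. c \<noteq> 0}"
proof -
  obtain w where w: "P = {(\<lambda>i. c * w i) | c. c \<noteq> 0}" "w \<in> pvecs m" "\<exists>i. w i \<noteq> 0"
    using assms(1) by (auto simp: Proj_def)
  obtain c where c: "v = (\<lambda>i. c * w i)" "c \<noteq> 0" using assms(2) w(1) by auto
  show "v \<in> pvecs m" using c w(2) by (auto simp: pvecs_def)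
  show "v \<noteq> (\<lambda>_. 0)" using c w(3) by (auto simp: fun_eq_iff)
  show "P = {(\<lambda>i. c * v i) | c. c \<noteq> 0}"
  proof (intro subset_antisym subsetI)
    fix x assume "x \<in> P"
    then obtain b where b: "x = (\<lambda>i. b * w i)" "b \<noteq> 0" using w(1) by auto
    have "x = (\<lambda>i. (b / c) * v i)" "b / c \<noteq> 0" using b c by auto
    then show "x \<in> {(\<lambda>i. c * v i) | c. c \<noteq> 0}" by blast
  next
    fix x assume "x \<in> {(\<lambda>i. c * v i) | c. c \<noteq> 0}"
    then obtain b where b: "x = (\<lambda>i. b * v i)" "b \<noteq> 0" by auto
    have "x = (\<lambda>i. (b * c) * w i)" "b * c \<noteq> 0" using b c by (auto simp: mult.assoc)
    then show "x \<in> P" unfolding w(1) by blast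
  qed
qed

lemma rep_in: "P \<in> Proj m \<Longrightarrow> rep P \<in> P"
proof -
  assume "P \<in> Proj m"
  then obtain w where w: "P = {(\<lambda>i. c * w i) | c. c \<noteq> 0}" by (auto simp: Proj_def)
  have "(\<lambda>i. 1 * w i) \<in> P" unfolding w by (rule CollectI, rule exI[of _ 1]) simp
  then show ?thesis unfolding rep_def by (rule someI[of "\<lambda>v. v \<in> P"])
qed

lemma Proj_disjoint:
  assumes "P \<in> Proj m" "Q \<in> Proj m" "v \<in> P" "v \<in> Q"
  shows "P = Q"
  using Proj_elem(3)[OF assms(1,3)] Proj_elem(3)[OF assms(2,4)] by simp

lemma Union_Proj: "\<Union> (Proj m) = pvecs m - {\<lambda>_. 0}"
proof (intro subset_antisym subsetI)
  fix v assume "v \<in> \<Union> (Proj m)"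
  then show "v \<in> pvecs m - {\<lambda>_. 0}" using Proj_elem(1,2) by blast
next
  fix v :: "nat \<Rightarrow> 'a" assume v: "v \<in> pvecs m - {\<lambda>_. 0}"
  then have "\<exists>i. v i \<noteq> 0" by (auto simp: fun_eq_iff)
  then have "{(\<lambda>i. c * v i) | c. c \<noteq> 0} \<in> Proj m" using v by (auto simp: Proj_def)
  moreover have "v \<in> {(\<lambda>i. c * v i) | c. c \<noteq> 0}" by (rule CollectI, rule exI[of _ 1]) simp
  ultimately show "v \<in> \<Union> (Proj m)" by blast
qed

lemma finite_Proj: "finite (Proj m :: (nat \<Rightarrow> 'a::{finite,field}) set set)"
proof (rule finite_UnionD)
  show "finite (\<Union> (Proj m) :: (nat \<Rightarrow> 'a) set)" unfolding Union_Proj using finite_pvecs by simp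
qed

lemma card_Proj: "card (Proj m :: (nat \<Rightarrow> 'a::{finite,field}) set set) = proj_card CARD('a) (Suc m)"
proof -
  let ?q = "CARD('a)"
  have "(?q - 1) * card (Proj m :: (nat \<Rightarrow> 'a) set set) = card (\<Union> (Proj m) :: (nat \<Rightarrow> 'a) set)"
  proof (rule card_partition)
    show "finite (\<Union> (Proj m) :: (nat \<Rightarrow> 'a) set)" unfolding Union_Proj using finite_pvecs by simp
    show "card P = ?q - 1" if P: "P \<in> Proj m" for P :: "(nat \<Rightarrow> 'a) set"
    proof -
      let ?v = "rep P"
      note E = Proj_elem[OF P rep_in[OF P]]
      obtain i where i: "?v i \<noteq> 0" using E(2) by auto
      have "P = (\<lambda>c i. c * ?v i) ` (UNIV - {0})" by (subst E(3)) auto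
      moreover have "inj_on (\<lambda>c i. c * ?v i) (UNIV - {0})"
        by (rule inj_onI) (metis i mult_cancel_right)
      ultimately have "card P = card (UNIV - {0 :: 'a})" by (metis card_image)
      then show ?thesis by (simp add: card_Diff_singleton)
    qed
    show "P \<inter> Q = {}" if "P \<in> Proj m" "Q \<in> Proj m" "P \<noteq> Q" for P Q :: "(nat \<Rightarrow> 'a) set"
      using Proj_disjoint[OF that(1,2)] that(3) by blast
  qed (rule finite_Proj)
  also have "\<dots> = ?q ^ Suc m - 1"
    unfolding Union_Proj
    using lin_closed_zero[OF lin_closed_pvecs[of m, where 'a = 'a]] card_pvecs[of m, where 'a = 'a]
    by (simp add: card_Diff_singleton del: power_Suc)
  also have "\<dots> = (?q - 1) * proj_card ?q (Suc m)"
    using proj_card_geometric[of ?q "Suc m"] by (simp add: diff_mult_distrib del: power_Suc)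
  finally show ?thesis using CARD_field_ge_2[where 'a = 'a] by simp
qed

lemma inj_on_rep: "inj_on rep (Proj m)"
proof (rule inj_onI)
  fix P Q :: "(nat \<Rightarrow> 'a::field) set"
  assume *: "P \<in> Proj m" "Q \<in> Proj m" "rep P = rep Q"
  show "P = Q" using Proj_disjoint[OF *(1,2)] rep_in[OF *(1)] rep_in[OF *(2)] *(3) by simp
qed

lemma rep_subset_pvecs: "S \<subseteq> Proj m \<Longrightarrow> rep ` S \<subseteq> pvecs m"
  using Proj_elem(1) rep_in by blast

lemma projset_rep:
  fixes S :: "(nat \<Rightarrow> 'a::field) set set"
  assumes "S \<subseteq> Proj m"
  shows "projset (rep ` S)"
  unfolding projset_def
proof (intro conjI ballI allI impI)
  fix v assume "v \<in> rep ` S"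
  then obtain P where P: "P \<in> Proj m" "v = rep P" using assms by blast
  show "v \<noteq> (\<lambda>_. 0)" unfolding P(2) by (rule Proj_elem(2)[OF P(1) rep_in[OF P(1)]])
next
  fix v w :: "nat \<Rightarrow> 'a" and c assume "v \<in> rep ` S" "w \<in> rep ` S" and w: "w = (\<lambda>i. c * v i)"
  then obtain P Q where PQ: "P \<in> Proj m" "Q \<in> Proj m" "v = rep P" "w = rep Q" using assms by blast
  have vP: "v \<in> P" and wQ: "w \<in> Q" unfolding PQ(3,4) by (rule rep_in[OF PQ(1)], rule rep_in[OF PQ(2)])
  have "c \<noteq> 0" using Proj_elem(2)[OF PQ(2) wQ] w by auto
  then have "w \<in> P" by (subst Proj_elem(3)[OF PQ(1) vP]) (use w in blast)
  then show "w = v" using Proj_disjoint[OF PQ(1,2) _ wQ] PQ by simp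
qed

lemma peval_homogeneous: "peval m d F (\<lambda>i. c * v i) = c ^ d * peval m d F v"
  by (rule forms_homogeneous[of "peval m d F" m]) (simp add: forms_def)

lemma peval_zero_on_point:
  assumes "P \<in> Proj m" "peval m d F (rep P) = 0"
  shows "\<forall>v\<in>P. peval m d F v = 0"
proof
  fix v assume "v \<in> P"
  then obtain c where "v = (\<lambda>i. c * rep P i)"
    using Proj_elem(3)[OF assms(1) rep_in[OF assms(1)]] by blast
  then show "peval m d F v = 0" using peval_homogeneous[of m d F c "rep P"] assms(2) by simp
qed

text \<open>By homogeneity, vanishing does not depend on the representative.\<close>

lemma zeros_alt: "zeros m d r fs = {P \<in> Proj m. \<forall>j<r. peval m d (fs j) (rep P) = 0}"
  unfolding zeros_def using peval_zero_on_point rep_in by blast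

section \<open>Coefficient families and linear independence\<close>

lemma lin_closed_zero_outside: "lin_closed {F :: 'b \<Rightarrow> 'a::field. \<forall>x. x \<notin> M \<longrightarrow> F x = 0}"
  by (auto simp: lin_closed_def)

lemma lin_closed_hom_polys: "lin_closed (hom_polys m d)"
  unfolding hom_polys_def by (rule lin_closed_zero_outside)

lemma finite_hom_polys: "finite (hom_polys m d :: ((nat \<Rightarrow> nat) \<Rightarrow> 'a::{finite,field}) set)"
  unfolding hom_polys_def by (rule finite_functions_zero_outside[OF finite_mon_exps])

lemma card_hom_polys:
  "card (hom_polys m d :: ((nat \<Rightarrow> nat) \<Rightarrow> 'a::{finite,field}) set) = CARD('a) ^ card (mon_exps m d)"
  unfolding hom_polys_def by (rule card_functions_zero_outside[OF finite_mon_exps])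

lemma forms_eq_hom_polys: "forms m d = peval m d ` hom_polys m d"
proof -
  have "peval m d F = peval m d (restr (mon_exps m d) F)" for F :: "(nat \<Rightarrow> nat) \<Rightarrow> 'a"
    by (simp add: peval_def restr_def fun_eq_iff)
  moreover have "restr (mon_exps m d) F \<in> hom_polys m d" for F :: "(nat \<Rightarrow> nat) \<Rightarrow> 'a"
    by (simp add: hom_polys_def restr_def)
  ultimately show ?thesis unfolding forms_def by blast
qed

text \<open>Rank-nullity for evaluation on \<open>X\<close>, which turns lower bounds on conditions
  into upper bounds on the space of vanishing polynomials.\<close>

lemma card_hom_polys_restr_forms:
  fixes X :: "(nat \<Rightarrow> 'a::{finite,field}) set"
  shows "CARD('a) ^ card (mon_exps m d) =
    card (restr_forms m d X) * card {F \<in> hom_polys m d. \<forall>v\<in>X. peval m d F v = 0}"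
proof -
  have "card (hom_polys m d :: ((nat \<Rightarrow> nat) \<Rightarrow> 'a) set) =
    card ((\<lambda>F. restr X (peval m d F)) ` hom_polys m d) *
    card {F \<in> hom_polys m d. restr X (peval m d F) = (\<lambda>_. 0)}"
    by (rule card_kernel_image[OF lin_closed_hom_polys finite_hom_polys])
      (auto simp: peval_add_scale restr_def)
  moreover have "(\<lambda>F. restr X (peval m d F)) ` hom_polys m d = restr_forms m d X"
    by (simp add: restr_forms_def forms_eq_hom_polys image_image)
  moreover have "restr X (peval m d F) = (\<lambda>_. 0) \<longleftrightarrow> (\<forall>v\<in>X. peval m d F v = 0)" for F
    by (auto simp: restr_def fun_eq_iff)
  ultimately show ?thesis by (simp add: card_hom_polys)
qed

lemma lin_closed_sum:
  assumes S: "lin_closed S" and "\<And>j. j < (r :: nat) \<Longrightarrow> fs j \<in> S"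
  shows "(\<lambda>x. \<Sum>j<r. c j * fs j x) \<in> S"
  using assms(2)
proof (induction r)
  case 0
  then show ?case using lin_closed_zero[OF S] by simp
next
  case (Suc r)
  then have "(\<lambda>x. (\<Sum>j<r. c j * fs j x) + c r * fs r x) \<in> S"
    by (intro lin_closedD[OF S]) auto
  then show ?case by simp
qed

lemma card_coefficient_vectors:
  "card {c :: nat \<Rightarrow> 'a::{finite,zero}. \<forall>j. j \<notin> {..<r} \<longrightarrow> c j = 0} = CARD('a) ^ r"
  by (subst card_functions_zero_outside) auto

lemma lin_indep_card:
  fixes S :: "('b \<Rightarrow> 'a::{finite,field}) set"
  assumes S: "lin_closed S" "finite S" and fs: "\<And>j. j < r \<Longrightarrow> fs j \<in> S" and li: "lin_indep r fs"
  shows "CARD('a) ^ r \<le> card S"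
proof -
  let ?C = "{c :: nat \<Rightarrow> 'a. \<forall>j. j \<notin> {..<r} \<longrightarrow> c j = 0}"
  have "card ?C \<le> card S"
  proof (rule card_inj_on_le[where f = "\<lambda>c x. \<Sum>j<r. c j * fs j x"])
    show "inj_on (\<lambda>c x. \<Sum>j<r. c j * fs j x) ?C"
    proof (rule inj_onI)
      fix c c' assume *: "c \<in> ?C" "c' \<in> ?C" "(\<lambda>x. \<Sum>j<r. c j * fs j x) = (\<lambda>x. \<Sum>j<r. c' j * fs j x)"
      have "(\<Sum>j<r. (c j - c' j) * fs j x) = 0" for x
        using fun_cong[OF *(3), of x] by (simp add: left_diff_distrib sum_subtractf)
      then have "\<forall>j<r. c j - c' j = 0" using li[unfolded lin_indep_def, rule_format, of "\<lambda>j. c j - c' j"] by blast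
      then show "c = c'" using * by (auto simp: fun_eq_iff) (metis lessThan_iff)
    qed
  qed (use lin_closed_sum[OF S(1) fs] S(2) in auto)
  then show ?thesis by (simp only: card_coefficient_vectors)
qed

text \<open>Greedy choice: \<open>r\<close> members have at most \<open>q ^ r\<close> combinations,
  so a larger \<open>S\<close> contains an element outside their span.\<close>

lemma lin_indep_exists:
  fixes S :: "('b \<Rightarrow> 'a::{finite,field}) set"
  assumes S: "lin_closed S" and "CARD('a) ^ r \<le> card S"
  shows "\<exists>fs. (\<forall>j<r. fs j \<in> S) \<and> lin_indep r fs"
  using assms(2)
proof (induction r)
  case 0
  then show ?case by (simp add: lin_indep_def)
next
  case (Suc r)
  let ?q = "CARD('a)"
  have lt: "?q ^ r < ?q ^ Suc r"
    using CARD_field_ge_2[where 'a = 'a] by (intro power_strict_increasing) auto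
  then have "?q ^ r \<le> card S" using Suc.prems by linarith
  then obtain fs where fs: "\<forall>j<r. fs j \<in> S" "lin_indep r fs" using Suc.IH by blast
  let ?C = "{c :: nat \<Rightarrow> 'a. \<forall>j. j \<notin> {..<r} \<longrightarrow> c j = 0}"
  let ?span = "(\<lambda>c x. \<Sum>j<r. c j * fs j x) ` ?C"
  have finC: "finite ?C" by (rule finite_functions_zero_outside) simp
  have "card ?span \<le> ?q ^ r" using card_image_le[OF finC] card_coefficient_vectors[where 'a = 'a] by metis
  then have "card ?span < card S" using lt Suc.prems by linarith
  then have "\<not> S \<subseteq> ?span" using card_mono[of ?span S] finC by force
  then obtain g where g: "g \<in> S" "g \<notin> ?span" by blast
  have notspan: "g \<noteq> (\<lambda>x. \<Sum>j<r. c j * fs j x)" for c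
  proof
    assume "g = (\<lambda>x. \<Sum>j<r. c j * fs j x)"
    then have "g = (\<lambda>x. \<Sum>j<r. restr {..<r} c j * fs j x)" by (simp add: restr_def)
    moreover have "restr {..<r} c \<in> ?C" by (simp add: restr_def)
    ultimately show False using g(2) by blast
  qed
  have "lin_indep (Suc r) (fs(r := g))"
    unfolding lin_indep_def
  proof (intro allI impI)
    fix c j assume z: "\<forall>x. (\<Sum>j<Suc r. c j * (fs(r := g)) j x) = 0" and j: "j < Suc r"
    have z': "(\<Sum>j<r. c j * fs j x) + c r * g x = 0" for x
      using spec[OF z, of x] by simp
    have "c r = 0"
    proof (rule ccontr)
      assume nz: "c r \<noteq> 0"
      have "g x = (\<Sum>j<r. (- c j / c r) * fs j x)" for x
      proof -
        have "(\<Sum>j<r. (- c j / c r) * fs j x) = (- 1 / c r) * (\<Sum>j<r. c j * fs j x)"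
          by (simp add: sum_distrib_left)
        also have "(\<Sum>j<r. c j * fs j x) = - (c r * g x)" using z'[of x] by (simp add: eq_neg_iff_add_eq_0)
        finally show ?thesis using nz by simp
      qed
      then have "g = (\<lambda>x. \<Sum>j<r. (- c j / c r) * fs j x)" by (rule ext)
      then show False using notspan by contradiction
    qed
    moreover from this have "\<forall>j<r. c j = 0" using z' fs(2) by (simp add: lin_indep_def)
    ultimately show "c j = 0" using j less_Suc_eq by auto
  qed
  moreover have "\<forall>j<Suc r. (fs(r := g)) j \<in> S" using fs(1) g(1) by (auto simp: less_Suc_eq)
  ultimately show ?case by blast
qed

lemma card_restr_forms_lower:
  fixes X :: "(nat \<Rightarrow> 'a::{finite,field}) set"
  assumes e: "e + 1 < CARD('a)" and X: "X \<subseteq> pvecs m" "projset X"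
    and c: "card X = proj_card CARD('a) k + v" "1 \<le> v" "v \<le> Suc e"
  shows "CARD('a) ^ (binom_sum e k + v) \<le> card (restr_forms m (Suc e) X)"
proof -
  let ?q = "CARD('a)"
  note q2 = CARD_field_ge_2[where 'a = 'a]
  note main = card_restr_forms_projective[OF e lin_closed_pvecs finite_pvecs subset_refl card_pvecs card_lins_pvecs X]
  show ?thesis
  proof (cases "v \<le> ?q ^ k")
    case True
    then show ?thesis using main[OF c(1,2) True] cond_bound_small[OF q2 _ c(3), of k] e by simp
  next
    \<comment> \<open>As \<open>v \<le> Suc e < q\<close>, an excess above \<open>q ^ k\<close>
      forces \<open>k = 0\<close>. The size is rewritten with index 1, where
      \<open>proj_card\<close> and \<open>binom_sum\<close> both gain 1 and the bound is the
      same.\<close>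
    case False
    have k0: "k = 0"
    proof (rule ccontr)
      assume "k \<noteq> 0"
      then have "?q ^ 1 \<le> ?q ^ k" using q2 by (intro power_increasing) auto
      then show False using False c(3) e by simp
    qed
    define v' where "v' = v - 1"
    have v': "1 \<le> v'" "v' \<le> Suc e" using False k0 c by (auto simp: v'_def)
    have "card X = proj_card ?q 1 + v'" using c(1,2) k0 by (simp add: proj_card_def v'_def)
    moreover have "v' \<le> ?q ^ 1" using v'(2) e by simp
    ultimately have "?q ^ cond_bound ?q e 1 v' \<le> card (restr_forms m (Suc e) X)" by (intro main v'(1))
    moreover have "cond_bound ?q e 1 v' = binom_sum e k + v"
      using cond_bound_small[OF q2 _ v'(2), of 1] e c(2) k0 by (simp add: binom_sum_def v'_def)
    ultimately show ?thesis by simp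
  qed
qed

subsection \<open>Common zeros and generalized Hamming weights\<close>

text \<open>One zero too many gives a subset of exactly \<open>proj_card q k + Suc t\<close> points;
  its conditions and the \<open>r\<close> independent polynomials together exceed the number of
  monomials. The excess \<open>Suc t \<le> Suc e\<close> is in the range where each extra point
  counts fully.\<close>

lemma card_zeros_le:
  fixes fs :: "nat \<Rightarrow> (nat \<Rightarrow> nat) \<Rightarrow> 'a::{finite,field}"
  assumes e: "e + 1 < CARD('a)" and t: "t \<le> e" and rt: "r + t + binom_sum e k = binom_sum e (Suc m)"
    and fs: "\<And>j. j < r \<Longrightarrow> fs j \<in> hom_polys m (Suc e)" "lin_indep r fs"
  shows "card (zeros m (Suc e) r fs) \<le> proj_card CARD('a) k + t"
proof (rule ccontr)
  let ?q = "CARD('a)" and ?Z = "zeros m (Suc e) r fs"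
  assume "\<not> ?thesis"
  then have "proj_card ?q k + Suc t \<le> card ?Z" by simp
  then obtain S where S: "S \<subseteq> ?Z" "card S = proj_card ?q k + Suc t"
    by (meson obtain_subset_with_card_n)
  have SP: "S \<subseteq> Proj m" using S(1) by (auto simp: zeros_def)
  define X where "X = rep ` S"
  have cX: "card X = proj_card ?q k + Suc t"
    unfolding X_def using card_image[OF inj_on_subset[OF inj_on_rep SP]] S(2) by simp
  have "?q ^ (binom_sum e k + Suc t) \<le> card (restr_forms m (Suc e) X)"
    using card_restr_forms_lower[OF e _ _ cX] rep_subset_pvecs[OF SP] projset_rep[OF SP] t by (simp add: X_def)
  moreover have "?q ^ r \<le> card {F \<in> hom_polys m (Suc e). \<forall>v\<in>X. peval m (Suc e) F v = 0}" (is "_ \<le> card ?K")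
  proof (rule lin_indep_card[OF _ _ _ fs(2)])
    show "lin_closed ?K"
      using lin_closedD[OF lin_closed_hom_polys] lin_closed_zero[OF lin_closed_hom_polys[of m "Suc e"]]
      by (auto simp: lin_closed_def peval_add_scale peval_def[of m "Suc e" "\<lambda>_. 0"])
    show "finite ?K" by (rule finite_subset[OF _ finite_hom_polys]) auto
    show "fs j \<in> ?K" if "j < r" for j
      using that fs(1) S(1) by (auto simp: X_def zeros_alt)
  qed
  ultimately have "?q ^ (binom_sum e k + Suc t) * ?q ^ r \<le> ?q ^ card (mon_exps m (Suc e))"
    unfolding card_hom_polys_restr_forms[of m "Suc e" X] by (rule mult_le_mono)
  then have "?q ^ (binom_sum e k + Suc t + r) \<le> ?q ^ binom_sum e (Suc m)"
    by (simp only: power_add card_mon_exps binom_sum_eq_choose)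
  then have "binom_sum e k + Suc t + r \<le> binom_sum e (Suc m)"
    using CARD_field_ge_2[where 'a = 'a] by (subst (asm) power_increasing_iff) auto
  then show False using rt by simp
qed

lemma exists_many_zeros:
  assumes e: "e + 1 < CARD('a::{finite,field})" and m: "1 \<le> m" and k: "k \<le> m" and t: "t \<le> e"
    and rt: "r + t + binom_sum e k = binom_sum e (Suc m)"
  shows "\<exists>fs :: nat \<Rightarrow> (nat \<Rightarrow> nat) \<Rightarrow> 'a. (\<forall>j<r. fs j \<in> hom_polys m (Suc e)) \<and> lin_indep r fs
    \<and> proj_card CARD('a) k + t \<le> card (zeros m (Suc e) r fs)"
proof -
  let ?q = "CARD('a)"
  note q2 = CARD_field_ge_2[where 'a = 'a]
  \<comment> \<open>The subspace where all coordinates from \<open>k\<close> on vanish.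
    \<open>k = 0\<close> is separate because \<open>Proj (0 - 1)\<close> is a point and not the
    empty set.\<close>
  define Z0 :: "(nat \<Rightarrow> 'a) set set" where "Z0 = (if k = 0 then {} else Proj (k - 1))"
  have cZ0: "card Z0 = proj_card ?q k" by (auto simp: Z0_def card_Proj proj_card_def)
  have "pvecs (k - 1) \<subseteq> (pvecs m :: (nat \<Rightarrow> 'a) set)" using k by (auto simp: pvecs_def)
  then have "Proj (k - 1) \<subseteq> (Proj m :: (nat \<Rightarrow> 'a) set set)" by (auto simp: Proj_def)
  then have Z0P: "Z0 \<subseteq> Proj m" by (auto simp: Z0_def)
  \<comment> \<open>Outside \<open>Z0\<close> at least \<open>q ^ m \<ge> q > t\<close> points
    remain.\<close>
  have "?q ^ 1 \<le> ?q ^ m" using m q2 by (intro power_increasing) auto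
  moreover have "proj_card ?q k \<le> proj_card ?q m" unfolding proj_card_def using k by (intro sum_mono2) auto
  ultimately have "t \<le> card (Proj m - Z0)"
    using e t cZ0 by (simp add: card_Diff_subset[OF finite_subset[OF Z0P finite_Proj] Z0P] card_Proj proj_card_Suc)
  then obtain S where S: "S \<subseteq> Proj m - Z0" "card S = t" "finite S"
    by (meson obtain_subset_with_card_n)
  \<comment> \<open>All monomials outside \<open>B\<close> vanish on \<open>Z0\<close>, and they
    span the space \<open>A\<close> of dimension \<open>r + t\<close>.\<close>
  define B where "B = {\<alpha> \<in> mon_exps m (Suc e). \<forall>i\<ge>k. \<alpha> i = 0}"
  have cB: "card B = binom_sum e k"
  proof (cases k)
    case 0
    then have "B = {}" by (auto simp: B_def mon_exps_def)
    then show ?thesis using 0 by (simp add: binom_sum_def)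
  next
    case (Suc k')
    have "(\<Sum>i\<le>m. \<alpha> i) = (\<Sum>i\<le>k'. \<alpha> i)" if "\<forall>i\<ge>k. \<alpha> i = 0" for \<alpha> :: "nat \<Rightarrow> nat"
      using that k Suc by (intro sum.mono_neutral_right) auto
    then have "B = mon_exps k' (Suc e)" using Suc k by (auto simp: B_def mon_exps_def Suc_le_eq)
    then show ?thesis using Suc by (simp only: card_mon_exps binom_sum_eq_choose)
  qed
  define A :: "((nat \<Rightarrow> nat) \<Rightarrow> 'a) set" where "A = {F. \<forall>\<alpha>. \<alpha> \<notin> mon_exps m (Suc e) - B \<longrightarrow> F \<alpha> = 0}"
  have Asub: "A \<subseteq> hom_polys m (Suc e)" by (auto simp: A_def hom_polys_def)
  have LA: "lin_closed A" unfolding A_def by (rule lin_closed_zero_outside)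
  have finA: "finite A" using Asub finite_hom_polys finite_subset by blast
  have cA: "card A = ?q ^ (r + t)"
  proof -
    have "card (mon_exps m (Suc e) - B) = card (mon_exps m (Suc e)) - card B"
      by (rule card_Diff_subset) (auto simp: B_def finite_mon_exps)
    moreover have "card (mon_exps m (Suc e)) = r + t + binom_sum e k"
      unfolding card_mon_exps rt binom_sum_eq_choose ..
    ultimately have "card (mon_exps m (Suc e) - B) = r + t + binom_sum e k - binom_sum e k" by (simp only: cB)
    then have "card (mon_exps m (Suc e) - B) = r + t" by simp
    then show ?thesis
      unfolding A_def by (subst card_functions_zero_outside) (simp_all add: finite_mon_exps)
  qed
  have AZ: "peval m (Suc e) F v = 0" if F: "F \<in> A" and P: "P \<in> Z0" "v \<in> P" for F P v
    unfolding peval_def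
  proof (rule sum.neutral, intro ballI)
    fix \<alpha> assume \<alpha>: "\<alpha> \<in> mon_exps m (Suc e)"
    show "F \<alpha> * (\<Prod>i\<le>m. v i ^ \<alpha> i) = 0"
    proof (cases "\<alpha> \<in> B")
      case True
      then show ?thesis using F by (simp add: A_def)
    next
      case False
      then obtain i where i: "k \<le> i" "\<alpha> i \<noteq> 0" using \<alpha> by (auto simp: B_def)
      have im: "i \<le> m" using i(2) \<alpha> by (intro leI) (auto simp: mon_exps_def)
      have k0: "k \<noteq> 0" using P by (auto simp: Z0_def split: if_splits)
      then have "v \<in> pvecs (k - 1)" using P Proj_elem(1)[of P "k - 1" v] by (simp add: Z0_def)
      then have "v i = 0" using i(1) k0 by (auto simp: pvecs_def)
      then have "v i ^ \<alpha> i = 0" using i(2) by simp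
      then have "(\<Prod>i\<le>m. v i ^ \<alpha> i) = 0" using im by (intro prod_zero) auto
      then show ?thesis by simp
    qed
  qed
  define K where "K = {F \<in> A. restr (rep ` S) (peval m (Suc e) F) = (\<lambda>_. 0)}"
  have LK: "lin_closed K"
  proof -
    have "restr (rep ` S) (peval m (Suc e) (\<lambda>_. 0)) = (\<lambda>_. 0 :: 'a)"
      by (auto simp: restr_def peval_def)
    moreover have "restr (rep ` S) (peval m (Suc e) (\<lambda>x. F x + c * G x)) = (\<lambda>_. 0)"
      if "restr (rep ` S) (peval m (Suc e) F) = (\<lambda>_. 0)" "restr (rep ` S) (peval m (Suc e) G) = (\<lambda>_. 0)"
      for F G :: "(nat \<Rightarrow> nat) \<Rightarrow> 'a" and c
    proof
      fix v
      show "restr (rep ` S) (peval m (Suc e) (\<lambda>x. F x + c * G x)) v = 0"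
        using fun_cong[OF that(1), of v] fun_cong[OF that(2), of v]
        by (cases "v \<in> rep ` S") (simp_all add: peval_add_scale restr_def)
    qed
    ultimately show ?thesis
      unfolding lin_closed_def K_def using lin_closed_zero[OF LA] lin_closedD[OF LA] by blast
  qed
  \<comment> \<open>The \<open>t\<close> points of \<open>S\<close> impose at most \<open>t\<close>
    conditions on \<open>A\<close>.\<close>
  have "?q ^ r \<le> card K"
  proof -
    let ?I = "(\<lambda>F. restr (rep ` S) (peval m (Suc e) F)) ` A"
    have "card A = card ?I * card K"
      unfolding K_def by (rule card_kernel_image[OF LA finA]) (auto simp: peval_add_scale restr_def)
    moreover have "card ?I \<le> ?q ^ t"
    proof -
      have "?I \<subseteq> {f. \<forall>x. x \<notin> rep ` S \<longrightarrow> f x = 0}" by (auto simp: restr_def)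
      then have "card ?I \<le> ?q ^ card (rep ` S)"
        using card_mono[OF finite_functions_zero_outside[of "rep ` S"]] S(3)
        by (simp add: card_functions_zero_outside[symmetric])
      also have "\<dots> \<le> ?q ^ t" using card_image_le[OF S(3), of rep] S(2) by (intro power_increasing) auto
      finally show ?thesis .
    qed
    ultimately have "?q ^ r * ?q ^ t \<le> card K * ?q ^ t"
      using cA by (metis mult.commute mult_le_mono1 power_add)
    then show ?thesis by simp
  qed
  from lin_indep_exists[OF LK this] obtain fs where fs: "\<forall>j<r. fs j \<in> K" "lin_indep r fs" by blast
  have "Z0 \<union> S \<subseteq> zeros m (Suc e) r fs"
  proof
    fix P assume P: "P \<in> Z0 \<union> S"
    then have PP: "P \<in> Proj m" using Z0P S(1) by blast
    have "peval m (Suc e) (fs j) (rep P) = 0" if j: "j < r" for j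
    proof (cases "P \<in> Z0")
      case True
      then show ?thesis using AZ[OF _ True rep_in[OF PP]] fs(1) j by (auto simp: K_def)
    next
      case False
      then have "rep P \<in> rep ` S" using P by blast
      moreover have "restr (rep ` S) (peval m (Suc e) (fs j)) = (\<lambda>_. 0)" using fs(1) j by (auto simp: K_def)
      ultimately show ?thesis by (metis restr_def)
    qed
    then show "P \<in> zeros m (Suc e) r fs" using PP by (simp add: zeros_alt)
  qed
  moreover have "finite (zeros m (Suc e) r fs)"
    by (rule finite_subset[OF _ finite_Proj]) (auto simp: zeros_def)
  ultimately have "card (Z0 \<union> S) \<le> card (zeros m (Suc e) r fs)" by (intro card_mono)
  moreover have "card (Z0 \<union> S) = proj_card ?q k + t"
    using S cZ0 finite_subset[OF Z0P finite_Proj] by (subst card_Un_disjoint) auto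
  ultimately show ?thesis using fs Asub by (intro exI[of _ fs]) (auto simp: K_def)
qed

section \<open>From polynomials to codewords\<close>

lemma codeword_add_scale_sum:
  fixes r :: nat
  shows "(\<Sum>j<r. a j * codeword m d (fs j) P) = codeword m d (\<lambda>\<alpha>. \<Sum>j<r. a j * fs j \<alpha>) P"
proof -
  have "peval m d (\<lambda>\<alpha>. \<Sum>j<r. a j * fs j \<alpha>) v = (\<Sum>j<r. a j * peval m d (fs j) v)" for v
  proof (induction r)
    case 0
    then show ?case by (simp add: peval_def)
  next
    case (Suc r)
    then show ?case using peval_add_scale[of m d "\<lambda>\<alpha>. \<Sum>j<r. a j * fs j \<alpha>" "a r" "fs r"] by simp
  qed
  then show ?thesis by (simp add: codeword_def)
qed

text \<open>By \<open>cond_bound_full\<close> the set of all points imposes as many conditions as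
  there are monomials, so only the zero polynomial vanishes everywhere.\<close>

lemma codeword_injective:
  fixes F :: "(nat \<Rightarrow> nat) \<Rightarrow> 'a::{finite,field}"
  assumes e: "e + 1 < CARD('a)" and m: "1 \<le> m" and F: "F \<in> hom_polys m (Suc e)"
    and z: "\<And>P. codeword m (Suc e) F P = 0"
  shows "F = (\<lambda>_. 0)"
proof -
  let ?q = "CARD('a)"
  note q2 = CARD_field_ge_2[where 'a = 'a]
  define X where "X = rep ` (Proj m :: (nat \<Rightarrow> 'a) set set)"
  have "card X = proj_card ?q m + ?q ^ m"
    unfolding X_def by (simp add: card_image[OF inj_on_rep] card_Proj proj_card_Suc)
  then have "?q ^ cond_bound ?q e m (?q ^ m) \<le> card (restr_forms m (Suc e) X)"
    unfolding X_def
    by (intro card_restr_forms_projective[OF e lin_closed_pvecs finite_pvecs subset_refl card_pvecs card_lins_pvecs])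
      (auto simp: projset_rep[OF subset_refl] rep_subset_pvecs)
  moreover have "?q ^ 1 \<le> ?q ^ m" using m q2 by (intro power_increasing) auto
  then have "cond_bound ?q e m (?q ^ m) = card (mon_exps m (Suc e))"
    using cond_bound_full[OF q2, of e m] e by (simp only: card_mon_exps binom_sum_eq_choose) simp
  ultimately have le: "?q ^ card (mon_exps m (Suc e)) \<le> card (restr_forms m (Suc e) X)" by simp
  let ?K = "{F \<in> hom_polys m (Suc e). \<forall>v\<in>X. peval m (Suc e) F v = 0}"
  have "card (restr_forms m (Suc e) X) * card ?K \<le> card (restr_forms m (Suc e) X) * 1"
    using le unfolding card_hom_polys_restr_forms[of m "Suc e" X] by simp
  moreover have "0 < card (restr_forms m (Suc e) X)" using le q2 by (metis less_le_trans not_gr_zero not_numeral_le_zero zero_less_power)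
  ultimately have "card ?K \<le> 1" by simp
  moreover have "finite ?K" by (rule finite_subset[OF _ finite_hom_polys]) auto
  moreover have "F \<in> ?K" using F z by (auto simp: X_def codeword_def) metis
  moreover have "(\<lambda>_. 0) \<in> ?K" using lin_closed_zero[OF lin_closed_hom_polys] by (auto simp: peval_def)
  ultimately show ?thesis by (auto simp: card_le_Suc0_iff_eq)
qed

text \<open>All combinations vanish at a point exactly when all generators do, so supports and
  common zeros are complementary.\<close>

lemma code_supp_codewords:
  "code_supp {(\<lambda>x. \<Sum>j<r. a j * codeword m d (fs j) x) | a. True} = Proj m - zeros m d r fs"
proof (intro subset_antisym subsetI)
  fix P assume "P \<in> code_supp {(\<lambda>x. \<Sum>j<r. a j * codeword m d (fs j) x) | a. True}"
  then obtain a where "(\<Sum>j<r. a j * codeword m d (fs j) P) \<noteq> 0" by (auto simp: code_supp_def)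
  then obtain j where "j < r" "codeword m d (fs j) P \<noteq> 0"
    by (metis (no_types, lifting) lessThan_iff mult_zero_right sum.neutral)
  then show "P \<in> Proj m - zeros m d r fs" by (auto simp: codeword_def zeros_alt split: if_splits)
next
  fix P assume P: "P \<in> Proj m - zeros m d r fs"
  then obtain j where j: "j < r" "peval m d (fs j) (rep P) \<noteq> 0" by (auto simp: zeros_alt)
  have "(\<Sum>i<r. (if i = j then 1 else 0) * codeword m d (fs i) P) = codeword m d (fs j) P"
    using j(1) by (simp add: if_distrib[of "\<lambda>x. x * _"] cong: if_cong)
  then have "(\<Sum>i<r. (if i = j then 1 else 0) * codeword m d (fs i) P) \<noteq> 0"
    using j P by (simp add: codeword_def)
  then show "P \<in> code_supp {(\<lambda>x. \<Sum>j<r. a j * codeword m d (fs j) x) | a. True}"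
    unfolding code_supp_def
    by (intro CollectI bexI[of _ "\<lambda>x. \<Sum>i<r. (if i = j then 1 else 0) * codeword m d (fs i) x"]
        exI[of _ "\<lambda>i. if i = j then 1 else 0"] conjI refl TrueI)
qed

lemma pp_eq_proj_card: "i \<le> Suc m \<Longrightarrow> pp q (int m - int i) = proj_card q (Suc m - i)"
proof (cases "i = Suc m")
  case False
  assume "i \<le> Suc m"
  with False have "i \<le> m" by simp
  then have "nat (int m - int i) = m - i" "Suc m - i = Suc (m - i)" "\<not> int m - int i < 0" by auto
  then show ?thesis by (simp add: pp_def proj_card_def lessThan_Suc_atMost del: sum.lessThan_Suc)
qed (simp add: pp_def proj_card_def)

theorem theorem6p4:
  fixes m d i t r :: nat
  assumes "m \<ge> 1"
    and "1 \<le> d" and "d < CARD('a)"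
    and "1 \<le> i" and "i \<le> m + 1"
    and "t < d"
    and "r + t = (\<Sum>a=1..i. (m + d - a) choose (d - 1))"
  shows "e_r TYPE('a::{finite,field}) r d m = pp (CARD('a)) (int m - int i) + t
    \<and> ghw (PRM m d :: ((nat \<Rightarrow> 'a) set \<Rightarrow> 'a) set) r
        = pp (CARD('a)) (int m) - pp (CARD('a)) (int m - int i) - t"
proof -
  let ?q = "CARD('a)"
  obtain e where d: "d = Suc e" using assms(2) by (cases d) auto
  \<comment> \<open>The vector space dimension of the subspace with \<open>pp q (m - i)\<close>
    points; \<open>k \<le> m\<close> comes from \<open>i \<ge> 1\<close>.\<close>
  define k where "k = Suc m - i"
  have e: "e + 1 < ?q" and t: "t \<le> e" and km: "k \<le> m"
    using assms d by (auto simp: k_def)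
  have rt: "r + t + binom_sum e k = binom_sum e (Suc m)"
    using binom_sum_split[of i m e] assms(5,7) d by (simp add: k_def)
  have pk: "pp ?q (int m - int i) = proj_card ?q k" using pp_eq_proj_card[of i m] assms(5) by (simp add: k_def)
  have pm: "pp ?q (int m) = proj_card ?q (Suc m)" using pp_eq_proj_card[of 0 m] by simp
  have zP: "zeros m d r fs \<subseteq> Proj m" for fs :: "nat \<Rightarrow> (nat \<Rightarrow> nat) \<Rightarrow> 'a"
    by (auto simp: zeros_def)
  have upper: "card (zeros m d r fs) \<le> proj_card ?q k + t"
    if "\<forall>j<r. fs j \<in> hom_polys m d" "lin_indep r fs" for fs :: "nat \<Rightarrow> (nat \<Rightarrow> nat) \<Rightarrow> 'a"
    using card_zeros_le[OF e t rt, of fs] that d by simp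
  obtain gs :: "nat \<Rightarrow> (nat \<Rightarrow> nat) \<Rightarrow> 'a" where gs: "\<forall>j<r. gs j \<in> hom_polys m d" "lin_indep r gs"
    "proj_card ?q k + t \<le> card (zeros m d r gs)"
    using exists_many_zeros[OF e assms(1) km t rt] d by blast
  have geq: "card (zeros m d r gs) = proj_card ?q k + t" using upper[OF gs(1,2)] gs(3) by simp
  have "e_r TYPE('a) r d m = proj_card ?q k + t"
    unfolding e_r_def
  proof (rule Max_eqI)
    show "finite {card (zeros m d r fs) | fs :: nat \<Rightarrow> (nat \<Rightarrow> nat) \<Rightarrow> 'a. (\<forall>j<r. fs j \<in> hom_polys m d) \<and> lin_indep r fs}"
      by (rule finite_subset[of _ "{..proj_card ?q k + t}"]) (use upper in auto)
    show "proj_card ?q k + t \<in> {card (zeros m d r fs) | fs :: nat \<Rightarrow> (nat \<Rightarrow> nat) \<Rightarrow> 'a. (\<forall>j<r. fs j \<in> hom_polys m d) \<and> lin_indep r fs}"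
      using gs(1,2) geq[symmetric] by blast
  qed (use upper in auto)
  moreover have "ghw (PRM m d :: ((nat \<Rightarrow> 'a) set \<Rightarrow> 'a) set) r = proj_card ?q (Suc m) - (proj_card ?q k + t)"
    unfolding ghw_def
  proof (rule Min_eqI)
    let ?W = "{card (code_supp {(\<lambda>x. \<Sum>j<r. a j * cs j x) | a. True}) | cs.
      (\<forall>j<r. cs j \<in> (PRM m d :: ((nat \<Rightarrow> 'a) set \<Rightarrow> 'a) set)) \<and> lin_indep r cs}"
    \<comment> \<open>Independent codewords lift to independent polynomials, since a relation
      between polynomials passes to codewords; the bound on zeros thus bounds every support from
      below.\<close>
    have elem: "\<exists>fs :: nat \<Rightarrow> (nat \<Rightarrow> nat) \<Rightarrow> 'a. (\<forall>j<r. fs j \<in> hom_polys m d) \<and> lin_indep r fs \<and>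
      card (code_supp {(\<lambda>x. \<Sum>j<r. a j * cs j x) | a. True}) = proj_card ?q (Suc m) - card (zeros m d r fs)"
      if cs: "\<forall>j<r. cs j \<in> (PRM m d :: ((nat \<Rightarrow> 'a) set \<Rightarrow> 'a) set)" "lin_indep r cs" for cs
    proof -
      have "\<forall>j. \<exists>F. j < r \<longrightarrow> F \<in> hom_polys m d \<and> cs j = codeword m d F"
        using cs(1) by (auto simp: PRM_def)
      from choice[OF this] obtain fs where
        fs: "\<And>j. j < r \<Longrightarrow> fs j \<in> hom_polys m d" "\<And>j. j < r \<Longrightarrow> cs j = codeword m d (fs j)" by blast
      have sum_eq: "(\<Sum>j<r. a j * cs j P) = (\<Sum>j<r. a j * codeword m d (fs j) P)" for a P
        by (rule sum.cong[OF refl]) (simp add: fs(2))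
      have "lin_indep r fs"
        unfolding lin_indep_def
      proof (rule allI, rule impI)
        fix c assume c: "\<forall>x. (\<Sum>j<r. c j * fs j x) = 0"
        have "(\<Sum>j<r. c j * cs j P) = 0" for P
        proof -
          have "(\<lambda>\<alpha>. \<Sum>j<r. c j * fs j \<alpha>) = (\<lambda>_. 0)" using c by (intro ext) blast
          then have "codeword m d (\<lambda>\<alpha>. \<Sum>j<r. c j * fs j \<alpha>) P = 0"
            by (simp only:) (simp add: codeword_def peval_def)
          then show ?thesis by (simp only: sum_eq codeword_add_scale_sum)
        qed
        then show "\<forall>j<r. c j = 0" using cs(2) unfolding lin_indep_def by blast
      qed
      moreover have "card (code_supp {(\<lambda>x. \<Sum>j<r. a j * cs j x) | a. True}) = proj_card ?q (Suc m) - card (zeros m d r fs)"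
        by (simp only: sum_eq code_supp_codewords card_Diff_subset[OF finite_subset[OF zP finite_Proj] zP] card_Proj)
      ultimately show ?thesis using fs(1) by (intro exI[of _ fs]) simp
    qed
    \<comment> \<open>The second inequality provides the finiteness needed for
      \<open>Min\<close>.\<close>
    have lower: "proj_card ?q (Suc m) - (proj_card ?q k + t) \<le> y \<and> y \<le> proj_card ?q (Suc m)" if yW: "y \<in> ?W" for y
    proof -
      obtain cs where cs: "y = card (code_supp {(\<lambda>x. \<Sum>j<r. a j * cs j x) | a. True})"
        "\<forall>j<r. cs j \<in> (PRM m d :: ((nat \<Rightarrow> 'a) set \<Rightarrow> 'a) set)" "lin_indep r cs" using yW by blast
      obtain fs :: "nat \<Rightarrow> (nat \<Rightarrow> nat) \<Rightarrow> 'a" where fs: "\<forall>j<r. fs j \<in> hom_polys m d" "lin_indep r fs"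
        "y = proj_card ?q (Suc m) - card (zeros m d r fs)" using elem[OF cs(2,3)] unfolding cs(1) by blast
      show ?thesis using upper[OF fs(1,2)] fs(3) by simp
    qed
    have "?W \<subseteq> {..proj_card ?q (Suc m)}" unfolding atMost_def using lower by blast
    then show "finite ?W" by (rule finite_subset) simp
    show "proj_card ?q (Suc m) - (proj_card ?q k + t) \<le> y" if "y \<in> ?W" for y using lower[OF that] by simp
    show "proj_card ?q (Suc m) - (proj_card ?q k + t) \<in> ?W"
    proof -
      \<comment> \<open>Here independence passes from polynomials to codewords, which rests on the
        injectivity of evaluation for \<open>d < q\<close>.\<close>
      define cs where "cs j = codeword m d (gs j)" for j
      have "lin_indep r cs"
        unfolding lin_indep_def
      proof (rule allI, rule impI)
        fix c assume c: "\<forall>P. (\<Sum>j<r. c j * cs j P) = 0"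
        let ?F = "\<lambda>\<alpha>. \<Sum>j<r. c j * gs j \<alpha>"
        have "codeword m (Suc e) ?F P = 0" for P
          using spec[OF c, of P] by (simp only: cs_def codeword_add_scale_sum d)
        moreover have "?F \<in> hom_polys m (Suc e)"
          using lin_closed_sum[OF lin_closed_hom_polys, of r gs m d c] gs(1) d by simp
        ultimately have "?F = (\<lambda>_. 0)" using codeword_injective[OF e assms(1)] by blast
        then have "\<forall>\<alpha>. ?F \<alpha> = 0" by (simp add: fun_eq_iff)
        then show "\<forall>j<r. c j = 0" using gs(2) unfolding lin_indep_def by blast
      qed
      moreover have "\<forall>j<r. cs j \<in> PRM m d" using gs(1) by (auto simp: cs_def PRM_def)
      moreover have "card (code_supp {(\<lambda>x. \<Sum>j<r. a j * cs j x) | a. True}) = proj_card ?q (Suc m) - (proj_card ?q k + t)"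
        by (simp only: cs_def code_supp_codewords card_Diff_subset[OF finite_subset[OF zP finite_Proj] zP] card_Proj geq)
      ultimately show ?thesis by (intro CollectI exI[of _ cs] conjI) auto
    qed
  qed
  ultimately show ?thesis using pk pm by simp
qed

end
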